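(* Suppose $\{G_i: i\in I\}$ is a set of CAP groups. Then $\mathrm{M}\left(\prod_{i\in I} G_i\right) \cong \prod_{i\in I} \mathrm{M}(G_i)$ (as $\prod_{i} G_i$-flows). More generally, if $H$ and $K$ are topological groups with $H$ CAP, then $\mathrm{M}(H\times K) \cong \mathrm{M}(H)\times \mathrm{M}(K)$ (as $(H\times K)$-flows).
   Context: All topological groups and spaces are Hausdorff. For a topological group $G$, a $G$-flow is a (non-empty) compact Hausdorff space with a continuous left action of $G$; a $G$-map is a continuous $G$-equivariant map; a subflow is a non-empty closed $G$-invariant subset; a flow is minimal if it has no proper subflow. For a $G$-flow $X$, $\mathrm{AP}_G(X)=\{x\in X:\overline{Gx}\text{ is minimal}\}$. $G$ is CAP if $\mathrm{AP}_G(X)$ is closed in $X$ for every $G$-flow $X$. $\mathrm{M}(G)$ denotes the universal minimal flow of $G$: the minimal $G$-flow, unique up to isomorphism of $G$-flows, which admits a $G$-map onto every minimal $G$-flow. Products of groups carry the product topology, and products of flows carry the coordinatewise action of the product group. *)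

theory Defs
  imports "HOL-Analysis.Analysis" "HOL-Algebra.Group_Action" "HOL-Algebra.Product_Groups"
begin

(* HOL-Algebra reuses the infix closure_of of topological spaces *)
no_notation eq_closure_of (\<open>closure'_of\<index>\<close>)

section \<open>Topological groups and flows\<close>

definition topological_group :: "('g, 'm) monoid_scheme \<Rightarrow> 'g topology \<Rightarrow> bool" where
  "topological_group G T \<longleftrightarrow>
     group G \<and> topspace T = carrier G \<and> Hausdorff_space T \<and>
     continuous_map (prod_topology T T) T (\<lambda>(g, h). g \<otimes>\<^bsub>G\<^esub> h) \<and>
     continuous_map T T (\<lambda>g. inv\<^bsub>G\<^esub> g)"

text \<open>The library's \<^const>\<open>group_action\<close> asks that each \<^term>\<open>\<phi> g\<close> be extensional on the
  underlying set; this is why the actions below are restricted functions.\<close>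

definition flow ::
  "('g, 'm) monoid_scheme \<Rightarrow> 'g topology \<Rightarrow> 'x topology \<Rightarrow> ('g \<Rightarrow> 'x \<Rightarrow> 'x) \<Rightarrow> bool" where
  "flow G T X \<phi> \<longleftrightarrow>
     topspace X \<noteq> {} \<and> compact_space X \<and> Hausdorff_space X \<and>
     group_action G (topspace X) \<phi> \<and>
     continuous_map (prod_topology T X) X (\<lambda>(g, x). \<phi> g x)"

definition G_map ::
  "('g, 'm) monoid_scheme \<Rightarrow> 'x topology \<Rightarrow> ('g \<Rightarrow> 'x \<Rightarrow> 'x) \<Rightarrow>
   'y topology \<Rightarrow> ('g \<Rightarrow> 'y \<Rightarrow> 'y) \<Rightarrow> ('x \<Rightarrow> 'y) \<Rightarrow> bool" where
  "G_map G X \<phi> Y \<psi> f \<longleftrightarrow>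
     continuous_map X Y f \<and>
     (\<forall>g \<in> carrier G. \<forall>x \<in> topspace X. f (\<phi> g x) = \<psi> g (f x))"

definition flow_isomorphic ::
  "('g, 'm) monoid_scheme \<Rightarrow> 'x topology \<Rightarrow> ('g \<Rightarrow> 'x \<Rightarrow> 'x) \<Rightarrow>
   'y topology \<Rightarrow> ('g \<Rightarrow> 'y \<Rightarrow> 'y) \<Rightarrow> bool" where
  "flow_isomorphic G X \<phi> Y \<psi> \<longleftrightarrow> (\<exists>f. homeomorphic_map X Y f \<and> G_map G X \<phi> Y \<psi> f)"

definition subflow ::
  "('g, 'm) monoid_scheme \<Rightarrow> 'x topology \<Rightarrow> ('g \<Rightarrow> 'x \<Rightarrow> 'x) \<Rightarrow> 'x set \<Rightarrow> bool" where
  "subflow G X \<phi> Y \<longleftrightarrow>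
     Y \<noteq> {} \<and> closedin X Y \<and> (\<forall>g \<in> carrier G. \<forall>y \<in> Y. \<phi> g y \<in> Y)"

definition minimal_flow ::
  "('g, 'm) monoid_scheme \<Rightarrow> 'g topology \<Rightarrow> 'x topology \<Rightarrow> ('g \<Rightarrow> 'x \<Rightarrow> 'x) \<Rightarrow> bool" where
  "minimal_flow G T X \<phi> \<longleftrightarrow>
     flow G T X \<phi> \<and> (\<forall>Y. subflow G X \<phi> Y \<longrightarrow> Y = topspace X)"

definition AP ::
  "('g, 'm) monoid_scheme \<Rightarrow> 'g topology \<Rightarrow> 'x topology \<Rightarrow> ('g \<Rightarrow> 'x \<Rightarrow> 'x) \<Rightarrow> 'x set" where
  "AP G T X \<phi> =
     {x \<in> topspace X.
        let C = X closure_of (orbit G \<phi> x)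
        in minimal_flow G T (subtopology X C) (\<lambda>g. restrict (\<phi> g) C)}"


section \<open>CAP groups and universal minimal flows\<close>

text \<open>Both notions quantify over all flows of \<open>G\<close>, but a HOL definition cannot quantify over the
  types in which flows live. We quantify over all flows whose points are taken from the single type
  \<open>'g flow_point\<close>, which is large enough: the lemmas \<open>CAP_closedin_AP\<close> and
  \<open>universal_minimal_flow_onto\<close> below derive the defining properties for flows in an arbitrary
  type, and \<open>universal_minimal_flow_exists\<close> shows that a universal minimal flow exists
  already in this type.\<close>

type_synonym 'g flow_point = "('g \<Rightarrow> real) set"

definition CAP :: "('g, 'm) monoid_scheme \<Rightarrow> 'g topology \<Rightarrow> bool" where
  "CAP G T \<longleftrightarrow>
     topological_group G T \<and>
     (\<forall>(X :: 'g flow_point topology) \<phi>. flow G T X \<phi> \<longrightarrow> closedin X (AP G T X \<phi>))"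

definition universal_minimal_flow ::
  "('g, 'm) monoid_scheme \<Rightarrow> 'g topology \<Rightarrow> 'x topology \<Rightarrow> ('g \<Rightarrow> 'x \<Rightarrow> 'x) \<Rightarrow> bool" where
  "universal_minimal_flow G T M \<mu> \<longleftrightarrow>
     minimal_flow G T M \<mu> \<and>
     (\<forall>(X :: 'g flow_point topology) \<phi>. minimal_flow G T X \<phi> \<longrightarrow>
        (\<exists>f. G_map G M \<mu> X \<phi> f \<and> f ` topspace M = topspace X))"


section \<open>Coordinatewise actions\<close>

definition product_action ::
  "'i set \<Rightarrow> ('i \<Rightarrow> 'x topology) \<Rightarrow> ('i \<Rightarrow> 'g \<Rightarrow> 'x \<Rightarrow> 'x) \<Rightarrow>
   ('i \<Rightarrow> 'g) \<Rightarrow> ('i \<Rightarrow> 'x) \<Rightarrow> ('i \<Rightarrow> 'x)" where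
  "product_action I X \<phi> g =
     (\<lambda>x \<in> topspace (product_topology X I). \<lambda>i\<in>I. \<phi> i (g i) (x i))"

definition prod_action ::
  "'x topology \<Rightarrow> ('h \<Rightarrow> 'x \<Rightarrow> 'x) \<Rightarrow> 'y topology \<Rightarrow> ('k \<Rightarrow> 'y \<Rightarrow> 'y) \<Rightarrow>
   'h \<times> 'k \<Rightarrow> 'x \<times> 'y \<Rightarrow> 'x \<times> 'y" where
  "prod_action X \<phi> Y \<psi> =
     (\<lambda>(h, k). restrict (\<lambda>(x, y). (\<phi> h x, \<psi> k y)) (topspace (prod_topology X Y)))"


section \<open>Elementary facts on flows\<close>

lemma group_actionI:
  assumes "group G" "\<And>g. g \<in> carrier G \<Longrightarrow> \<phi> g \<in> extensional E"
    and cl: "\<And>g x. g \<in> carrier G \<Longrightarrow> x \<in> E \<Longrightarrow> \<phi> g x \<in> E"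
    and one: "\<And>x. x \<in> E \<Longrightarrow> \<phi> \<one>\<^bsub>G\<^esub> x = x"
    and mult: "\<And>g h x. g \<in> carrier G \<Longrightarrow> h \<in> carrier G \<Longrightarrow> x \<in> E \<Longrightarrow>
                 \<phi> (g \<otimes>\<^bsub>G\<^esub> h) x = \<phi> g (\<phi> h x)"
  shows "group_action G E \<phi>"
proof -
  interpret group G by fact
  have inv: "\<phi> (inv\<^bsub>G\<^esub> g) (\<phi> g x) = x" "\<phi> g (\<phi> (inv\<^bsub>G\<^esub> g) x) = x"
    if "g \<in> carrier G" "x \<in> E" for g x
    using that mult[of "inv\<^bsub>G\<^esub> g" g x] mult[of g "inv\<^bsub>G\<^esub> g" x] one by auto
  have bij: "\<phi> g \<in> Bij E" if "g \<in> carrier G" for g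
    unfolding Bij_def using that assms(2)
    by (auto intro!: bij_betw_byWitness[where f' = "\<phi> (inv\<^bsub>G\<^esub> g)"] simp: inv cl)
  have "\<phi> (g \<otimes>\<^bsub>G\<^esub> h) = \<phi> g \<otimes>\<^bsub>BijGroup E\<^esub> \<phi> h" if "g \<in> carrier G" "h \<in> carrier G" for g h
    using that bij assms(2) mult
    by (auto simp: BijGroup_def compose_def fun_eq_iff extensional_def)
  then have "\<phi> \<in> hom G (BijGroup E)"
    using bij by (auto simp: hom_def BijGroup_def)
  then show ?thesis
    by (simp add: group_action_def group_hom_def group_hom_axioms_def group_BijGroup is_group)
qed

lemma flow_group: "flow G T X \<phi> \<Longrightarrow> group G"
  by (simp add: flow_def group_action_def group_hom_def)

lemma flow_closed: "flow G T X \<phi> \<Longrightarrow> g \<in> carrier G \<Longrightarrow> x \<in> topspace X \<Longrightarrow> \<phi> g x \<in> topspace X"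
  unfolding flow_def using group_action.element_image by fastforce

lemma flow_one: "flow G T X \<phi> \<Longrightarrow> x \<in> topspace X \<Longrightarrow> \<phi> \<one>\<^bsub>G\<^esub> x = x"
  unfolding flow_def using group_action.id_eq_one by (metis restrict_apply')

lemma flow_mult:
  "flow G T X \<phi> \<Longrightarrow> g \<in> carrier G \<Longrightarrow> h \<in> carrier G \<Longrightarrow> x \<in> topspace X \<Longrightarrow>
     \<phi> (g \<otimes>\<^bsub>G\<^esub> h) x = \<phi> g (\<phi> h x)"
  unfolding flow_def using group_action.composition_rule by metis

lemma flow_continuous:
  assumes "flow G T X \<phi>" "topspace T = carrier G" "g \<in> carrier G"
  shows "continuous_map X X (\<phi> g)"
proof -
  have "continuous_map X (prod_topology T X) (\<lambda>x. (g, x))"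
    using assms by (auto simp: continuous_map_pairwise comp_def)
  then have "continuous_map X X ((\<lambda>(g, x). \<phi> g x) \<circ> (\<lambda>x. (g, x)))"
    using assms(1) by (meson continuous_map_compose flow_def)
  then show ?thesis by (simp add: comp_def)
qed

lemma flow_restrict:
  assumes X: "flow G T X \<phi>" and T: "topspace T = carrier G" and Y: "subflow G X \<phi> Y"
  shows "flow G T (subtopology X Y) (\<lambda>g. restrict (\<phi> g) Y)"
proof -
  have Y': "Y \<subseteq> topspace X" "closedin X Y" "Y \<noteq> {}"
    and inv: "\<And>g y. g \<in> carrier G \<Longrightarrow> y \<in> Y \<Longrightarrow> \<phi> g y \<in> Y"
    using Y closedin_subset by (auto simp: subflow_def)
  have top: "topspace (subtopology X Y) = Y"
    using Y' by auto
  have "group_action G Y (\<lambda>g. restrict (\<phi> g) Y)"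
  proof (rule group_actionI)
    show "group G" using X by (rule flow_group)
    then interpret group G .
    show "restrict (\<phi> \<one>\<^bsub>G\<^esub>) Y x = x" if "x \<in> Y" for x
      using flow_one[OF X] that Y' by auto
    show "restrict (\<phi> (g \<otimes>\<^bsub>G\<^esub> h)) Y x = restrict (\<phi> g) Y (restrict (\<phi> h) Y x)"
      if "g \<in> carrier G" "h \<in> carrier G" "x \<in> Y" for g h x
      using flow_mult[OF X, of g h x] that Y' inv by auto
  qed (auto simp: inv)
  moreover have "continuous_map (prod_topology T (subtopology X Y)) (subtopology X Y)
                   (\<lambda>(g, x). restrict (\<phi> g) Y x)"
  proof -
    have "continuous_map (subtopology (prod_topology T X) (UNIV \<times> Y)) X (\<lambda>(g, x). \<phi> g x)"
      using X by (auto simp: flow_def intro: continuous_map_from_subtopology)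
    then have "continuous_map (prod_topology T (subtopology X Y)) X (\<lambda>(g, x). \<phi> g x)"
      by (simp add: subtopology_Times)
    then have "continuous_map (prod_topology T (subtopology X Y)) X (\<lambda>(g, x). restrict (\<phi> g) Y x)"
      by (rule continuous_map_eq) auto
    then show ?thesis
      by (rule continuous_map_into_subtopology) (auto simp: T inv)
  qed
  ultimately show ?thesis
    using X Y' top
    by (auto simp: flow_def Hausdorff_space_subtopology closedin_compact_space
        intro: compact_space_subtopology)
qed

lemma subflow_restrict_iff:
  assumes "closedin X Y"
  shows "subflow G (subtopology X Y) (\<lambda>g. restrict (\<phi> g) Y) Z \<longleftrightarrow> subflow G X \<phi> Z \<and> Z \<subseteq> Y"
  using assms by (auto simp: subflow_def closedin_closed_subtopology subset_iff)

text \<open>Minimality of a subflow can be tested inside the ambient flow.\<close>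

lemma minimal_flow_restrict_iff:
  assumes "flow G T X \<phi>" "topspace T = carrier G" "subflow G X \<phi> Y"
  shows "minimal_flow G T (subtopology X Y) (\<lambda>g. restrict (\<phi> g) Y) \<longleftrightarrow>
           (\<forall>Z. subflow G X \<phi> Z \<and> Z \<subseteq> Y \<longrightarrow> Z = Y)"
proof -
  have "closedin X Y" "topspace (subtopology X Y) = Y"
    using assms(3) closedin_subset by (fastforce simp: subflow_def)+
  then show ?thesis
    using flow_restrict[OF assms] by (simp add: minimal_flow_def subflow_restrict_iff)
qed

lemma orbit_subset: "flow G T X \<phi> \<Longrightarrow> x \<in> topspace X \<Longrightarrow> orbit G \<phi> x \<subseteq> topspace X"
  by (auto simp: orbit_def flow_closed)

lemma subflow_orbit_closure:
  assumes X: "flow G T X \<phi>" and T: "topspace T = carrier G" and x: "x \<in> topspace X"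
  shows "subflow G X \<phi> (X closure_of orbit G \<phi> x)" "x \<in> X closure_of orbit G \<phi> x"
proof -
  interpret group G using X by (rule flow_group)
  have "x \<in> orbit G \<phi> x"
    unfolding orbit_def using flow_one[OF X x] by (auto intro!: exI[of _ "\<one>\<^bsub>G\<^esub>"])
  then show x': "x \<in> X closure_of orbit G \<phi> x"
    using closure_of_subset[OF orbit_subset[OF X x]] by auto
  have "\<phi> g y \<in> X closure_of orbit G \<phi> x" if g: "g \<in> carrier G" and y: "y \<in> X closure_of orbit G \<phi> x" for g y
  proof -
    have "\<phi> g ` orbit G \<phi> x \<subseteq> orbit G \<phi> x"
      unfolding orbit_def using flow_mult[OF X g _ x] g by (auto, metis m_closed)
    moreover have "\<phi> g y \<in> X closure_of (\<phi> g ` orbit G \<phi> x)"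
      using continuous_map_image_closure_subset[OF flow_continuous[OF X T g]] y by blast
    ultimately show ?thesis using closure_of_mono by blast
  qed
  then show "subflow G X \<phi> (X closure_of orbit G \<phi> x)"
    using x' by (auto simp: subflow_def)
qed

lemma subflow_closure_subset:
  assumes "subflow G X \<phi> Y" "y \<in> Y"
  shows "X closure_of orbit G \<phi> y \<subseteq> Y"
  using assms by (intro closure_of_minimal) (auto simp: subflow_def orbit_def)

lemma AP_iff:
  assumes "flow G T X \<phi>" "topspace T = carrier G"
  shows "x \<in> AP G T X \<phi> \<longleftrightarrow> x \<in> topspace X \<and>
           (\<forall>Z. subflow G X \<phi> Z \<and> Z \<subseteq> X closure_of orbit G \<phi> x \<longrightarrow> Z = X closure_of orbit G \<phi> x)"
  using minimal_flow_restrict_iff[OF assms subflow_orbit_closure(1)[OF assms]]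
  by (auto simp: AP_def Let_def)

lemma subflow_image:
  assumes X: "flow G T X \<phi>" and Y: "Hausdorff_space Y"
    and f: "G_map G X \<phi> Y \<psi> f" and Z: "subflow G X \<phi> Z"
  shows "subflow G Y \<psi> (f ` Z)"
proof -
  have Z': "closedin X Z" "Z \<subseteq> topspace X" "Z \<noteq> {}"
    using Z closedin_subset by (auto simp: subflow_def)
  have "compactin X Z"
    using Z' X by (simp add: closedin_compact_space flow_def)
  then have "compactin Y (f ` Z)"
    using f image_compactin by (auto simp: G_map_def)
  then have "closedin Y (f ` Z)"
    using Y by (rule compactin_imp_closedin[rotated])
  moreover have "\<psi> g (f z) \<in> f ` Z" if "g \<in> carrier G" "z \<in> Z" for g z
  proof -
    have "\<psi> g (f z) = f (\<phi> g z)" using f that Z' by (auto simp: G_map_def)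
    then show ?thesis using Z that by (auto simp: subflow_def)
  qed
  ultimately show ?thesis using Z' by (auto simp: subflow_def)
qed

lemma subflow_preimage:
  assumes X: "flow G T X \<phi>" and f: "G_map G X \<phi> Y \<psi> f" and Z: "subflow G X \<phi> Z"
    and W: "subflow G Y \<psi> W" "W \<subseteq> f ` Z"
  shows "subflow G X \<phi> {z \<in> Z. f z \<in> W}"
proof -
  have Z': "closedin X Z" "Z \<subseteq> topspace X"
    using Z closedin_subset by (auto simp: subflow_def)
  have "closedin X {x \<in> topspace X. f x \<in> W}"
    using f W by (auto simp: G_map_def subflow_def intro: closedin_continuous_map_preimage)
  then have "closedin X (Z \<inter> {x \<in> topspace X. f x \<in> W})"
    using Z' by blast
  moreover have "Z \<inter> {x \<in> topspace X. f x \<in> W} = {z \<in> Z. f z \<in> W}" using Z' by auto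
  ultimately have "closedin X {z \<in> Z. f z \<in> W}" by simp
  moreover have "f (\<phi> g z) \<in> W" if "g \<in> carrier G" "z \<in> Z" "f z \<in> W" for g z
    using f W that Z' by (auto simp: G_map_def subflow_def subset_iff)
  ultimately show ?thesis
    using W Z by (auto simp: subflow_def)
qed

lemma minimal_flowD: "minimal_flow G T X \<phi> \<Longrightarrow> subflow G X \<phi> Y \<Longrightarrow> Y = topspace X"
  unfolding minimal_flow_def by blast

lemma minimal_image:
  assumes X: "minimal_flow G T X \<phi>" and Y: "flow G T Y \<psi>"
    and f: "G_map G X \<phi> Y \<psi> f" and "f ` topspace X = topspace Y"
  shows "minimal_flow G T Y \<psi>"
  unfolding minimal_flow_def
proof (intro conjI allI impI)
  fix W assume W: "subflow G Y \<psi> W"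
  have X': "flow G T X \<phi>" using X by (simp add: minimal_flow_def)
  then have "subflow G X \<phi> (topspace X)"
    by (auto simp: subflow_def flow_closed flow_def)
  moreover have "W \<subseteq> topspace Y"
    using W by (simp add: subflow_def closedin_subset)
  ultimately have "subflow G X \<phi> {z \<in> topspace X. f z \<in> W}"
    using subflow_preimage[OF X' f _ W] assms(4) by simp
  then have "{z \<in> topspace X. f z \<in> W} = topspace X"
    by (rule minimal_flowD[OF X])
  then have "f ` topspace X \<subseteq> W" by auto
  then have "topspace Y \<subseteq> W" by (simp only: assms(4))
  then show "W = topspace Y" using \<open>W \<subseteq> topspace Y\<close> by blast
qed fact

lemma minimal_map_surj:
  assumes X: "flow G T X \<phi>" and Y: "minimal_flow G T Y \<psi>" and f: "G_map G X \<phi> Y \<psi> f"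
  shows "f ` topspace X = topspace Y"
proof -
  have "subflow G X \<phi> (topspace X)"
    using X by (auto simp: subflow_def flow_closed flow_def)
  then have "subflow G Y \<psi> (f ` topspace X)"
    using X Y f by (intro subflow_image[OF X]) (simp_all add: minimal_flow_def flow_def)
  then show ?thesis by (rule minimal_flowD[OF Y])
qed

lemma image_orbit_closure:
  assumes X: "flow G T X \<phi>" and T: "topspace T = carrier G" and Y: "Hausdorff_space Y"
    and f: "G_map G X \<phi> Y \<psi> f" and x: "x \<in> topspace X"
  shows "f ` (X closure_of orbit G \<phi> x) = Y closure_of orbit G \<psi> (f x)"
proof
  have "f ` orbit G \<phi> x = orbit G \<psi> (f x)"
    using f x unfolding orbit_def G_map_def by (auto simp: image_iff) metis
  then show "f ` (X closure_of orbit G \<phi> x) \<subseteq> Y closure_of orbit G \<psi> (f x)"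
    using f continuous_map_image_closure_subset unfolding G_map_def by metis
  have "subflow G Y \<psi> (f ` (X closure_of orbit G \<phi> x))" "f x \<in> f ` (X closure_of orbit G \<phi> x)"
    using subflow_image[OF X Y f] subflow_orbit_closure[OF X T x] by auto
  then show "Y closure_of orbit G \<psi> (f x) \<subseteq> f ` (X closure_of orbit G \<phi> x)"
    by (rule subflow_closure_subset)
qed

lemma AP_image:
  assumes X: "flow G T X \<phi>" and T: "topspace T = carrier G" and Y: "flow G T Y \<psi>"
    and f: "G_map G X \<phi> Y \<psi> f" and x: "x \<in> AP G T X \<phi>"
  shows "f x \<in> AP G T Y \<psi>"
proof -
  let ?C = "X closure_of orbit G \<phi> x"
  have x': "x \<in> topspace X" and min: "\<And>Z. subflow G X \<phi> Z \<Longrightarrow> Z \<subseteq> ?C \<Longrightarrow> Z = ?C"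
    using x by (auto simp: AP_iff[OF X T])
  have C: "f ` ?C = Y closure_of orbit G \<psi> (f x)"
    using image_orbit_closure[OF X T _ f x'] Y by (auto simp: flow_def)
  have "W = f ` ?C" if W: "subflow G Y \<psi> W" "W \<subseteq> f ` ?C" for W
  proof -
    have "subflow G X \<phi> {z \<in> ?C. f z \<in> W}"
      using subflow_preimage[OF X f subflow_orbit_closure(1)[OF X T x'] W] .
    then have "{z \<in> ?C. f z \<in> W} = ?C" using min by auto
    then show ?thesis using W(2) by auto
  qed
  moreover have "f x \<in> topspace Y"
    using f x' by (auto simp: G_map_def continuous_map_def)
  ultimately show ?thesis by (auto simp: AP_iff[OF Y T] C[symmetric])
qed

text \<open>A continuous surjection of a flow onto a Hausdorff space whose fibres are permuted by the
  group carries the action over to its image.\<close>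

lemma flow_factor:
  assumes X: "flow G T X \<phi>" and T: "topspace T = carrier G"
    and Y: "Hausdorff_space Y" and f: "continuous_map X Y f" "f ` topspace X = topspace Y"
    and comp: "\<And>g x y. g \<in> carrier G \<Longrightarrow> x \<in> topspace X \<Longrightarrow> y \<in> topspace X \<Longrightarrow> f x = f y \<Longrightarrow>
                 f (\<phi> g x) = f (\<phi> g y)"
  obtains \<psi> where "flow G T Y \<psi>" "G_map G X \<phi> Y \<psi> f"
proof -
  define \<psi> where "\<psi> g = restrict (\<lambda>p. f (\<phi> g (inv_into (topspace X) f p))) (topspace Y)" for g
  have eq: "\<psi> g (f x) = f (\<phi> g x)" if "g \<in> carrier G" "x \<in> topspace X" for g x
  proof -
    have "f x \<in> f ` topspace X" using that by blast
    then have "inv_into (topspace X) f (f x) \<in> topspace X" "f (inv_into (topspace X) f (f x)) = f x"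
      by (simp_all add: inv_into_into f_inv_into_f)
    then show ?thesis using that f(2) comp[of g "inv_into (topspace X) f (f x)" x]
      by (auto simp: \<psi>_def)
  qed
  have ex: "\<exists>x \<in> topspace X. p = f x" if "p \<in> topspace Y" for p
    using that f(2) by auto
  have fY: "f x \<in> topspace Y" if "x \<in> topspace X" for x
    using that f(2) by auto
  interpret group G using X by (rule flow_group)
  have "group_action G (topspace Y) \<psi>"
  proof (rule group_actionI)
    show "\<psi> g p \<in> topspace Y" if "g \<in> carrier G" "p \<in> topspace Y" for g p
      using ex[OF that(2)] that eq fY flow_closed[OF X] by auto
    show "\<psi> \<one>\<^bsub>G\<^esub> p = p" if "p \<in> topspace Y" for p
      using ex[OF that] eq flow_one[OF X] by auto
    show "\<psi> (g \<otimes>\<^bsub>G\<^esub> h) p = \<psi> g (\<psi> h p)"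
      if "g \<in> carrier G" "h \<in> carrier G" "p \<in> topspace Y" for g h p
      using ex[OF that(3)] that eq flow_mult[OF X] flow_closed[OF X] by auto
  qed (auto simp: \<psi>_def is_group)
  moreover have "continuous_map (prod_topology T Y) Y (\<lambda>(g, p). \<psi> g p)"
  proof (rule continuous_compose_quotient_map)
    have "proper_map X Y f"
      using X Y f by (auto simp: flow_def intro: continuous_imp_proper_map Hausdorff_imp_kc_space)
    then have pm: "proper_map (prod_topology T X) (prod_topology T Y) (\<lambda>(g, x). (g, f x))"
      using proper_map_id[of T] proper_map_prod[of T X T Y "\<lambda>g. g" f] by (simp add: id_def)
    have "continuous_map (prod_topology T X) (prod_topology T Y) (\<lambda>(g, x). (g, f x))"
      using f(1) continuous_map_prod_top[of T X T Y "\<lambda>g. g" f] by auto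
    moreover have "(\<lambda>(g, x). (g, f x)) ` topspace (prod_topology T X) = topspace (prod_topology T Y)"
      using f(2) by (force simp: image_iff)
    ultimately show "quotient_map (prod_topology T X) (prod_topology T Y) (\<lambda>(g, x). (g, f x))"
      using proper_imp_closed_map[OF pm] by (intro continuous_closed_imp_quotient_map)
    have "continuous_map (prod_topology T X) Y (f \<circ> (\<lambda>(g, x). \<phi> g x))"
      using X f(1) by (auto simp: flow_def intro: continuous_map_compose)
    then show "continuous_map (prod_topology T X) Y ((\<lambda>(g, p). \<psi> g p) \<circ> (\<lambda>(g, x). (g, f x)))"
      by (rule continuous_map_eq) (auto simp: T eq)
  qed
  moreover have "compact_space Y"
    using X f image_compactin[of X "topspace X" Y f] by (auto simp: flow_def compact_space_def)
  ultimately have "flow G T Y \<psi>"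
    using X Y f(2) by (auto simp: flow_def)
  moreover have "G_map G X \<phi> Y \<psi> f"
    using f(1) eq by (simp add: G_map_def)
  ultimately show ?thesis by (rule that)
qed

lemma flow_transfer:
  fixes X :: "'x topology" and e :: "'x \<Rightarrow> 'y"
  assumes X: "flow G T X \<phi>" and T: "topspace T = carrier G" and e: "inj_on e (topspace X)"
  obtains Y \<psi> where "flow G T Y \<psi>" "G_map G X \<phi> Y \<psi> e" "homeomorphic_map X Y e"
    "topspace Y = e ` topspace X"
proof -
  let ?i = "inv_into (topspace X) e"
  define Y where "Y = pullback_topology (e ` topspace X) ?i X"
  have topY: "topspace Y = e ` topspace X"
    using e by (auto simp: Y_def topspace_pullback_topology)
  have i: "continuous_map Y X ?i"
    unfolding Y_def using continuous_map_pullback[OF continuous_map_id] by (metis id_comp)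
  have "continuous_map X Y e"
    unfolding Y_def
    by (rule continuous_map_pullback') (use e in \<open>auto intro: continuous_map_eq[of X X id]\<close>)
  then have hom: "homeomorphic_map X Y e"
    using i e topY unfolding homeomorphic_map_maps homeomorphic_maps_def
    by (intro exI[of _ ?i]) (auto simp: f_inv_into_f)
  then have "Hausdorff_space Y"
    using X homeomorphic_Hausdorff_space homeomorphic_map_imp_homeomorphic_space
    by (fastforce simp: flow_def)
  then obtain \<psi> where "flow G T Y \<psi>" "G_map G X \<phi> Y \<psi> e"
    using flow_factor[OF X T _ \<open>continuous_map X Y e\<close> topY[symmetric]] e
    by (metis inj_on_eq_iff)
  then show ?thesis using hom topY that by blast
qed

text \<open>Fix a base point \<open>x\<close> of a minimal flow. Its orbit is dense, so a point \<open>y\<close> is determined by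
  the sets of group elements \<open>A\<close> such that \<open>y\<close> lies in the closure of \<open>A x\<close>.\<close>

lemma minimal_flow_inj:
  fixes X :: "'x topology"
  assumes X: "minimal_flow (G :: ('g, 'm) monoid_scheme) T X \<phi>" and T: "topspace T = carrier G"
  obtains e :: "'x \<Rightarrow> 'g flow_point" where "inj_on e (topspace X)"
proof -
  have F: "flow G T X \<phi>" using X by (simp add: minimal_flow_def)
  then obtain x where x: "x \<in> topspace X" by (meson ex_in_conv flow_def)
  have dense: "X closure_of orbit G \<phi> x = topspace X"
    using minimal_flowD[OF X subflow_orbit_closure(1)[OF F T x]] .
  define e where "e y = {A. y \<in> X closure_of ((\<lambda>g. \<phi> g x) ` (A \<inter> carrier G))}" for y
  have inj: "inj_on e (topspace X)"
  proof (rule inj_onI, rule ccontr)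
    fix y z assume yz: "y \<in> topspace X" "z \<in> topspace X" "e y = e z" "y \<noteq> z"
    then obtain U V where UV: "openin X U" "openin X V" "y \<in> U" "z \<in> V" "disjnt U V"
      using F by (metis flow_def Hausdorff_space_def)
    define A where "A = {g. \<phi> g x \<in> U}"
    have A: "(\<lambda>g. \<phi> g x) ` (A \<inter> carrier G) = U \<inter> orbit G \<phi> x"
      by (auto simp: A_def orbit_def)
    have "y \<in> X closure_of (U \<inter> orbit G \<phi> x)"
      using UV dense openin_Int_closure_of_subset[of X U "orbit G \<phi> x"] openin_subset by blast
    then have "A \<in> e z" using yz(3) by (auto simp: e_def A[symmetric])
    then have "z \<in> X closure_of (U \<inter> orbit G \<phi> x)" by (simp add: e_def A)
    then show False using UV by (auto simp: in_closure_of disjnt_iff)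
  qed
  define c :: "'g set \<Rightarrow> 'g \<Rightarrow> real" where "c A = indicator A" for A
  have "inj c"
    by (rule inj_on_inverseI[where g = "\<lambda>f. {g. f g = 1}"]) (auto simp: c_def indicator_def)
  then have "inj_on (image c \<circ> e) (topspace X)"
    using inj by (intro comp_inj_on) (auto simp: inj_on_def inj_image_eq_iff)
  then show ?thesis using that by blast
qed

lemma universal_minimal_flow_onto:
  fixes X :: "'x topology" and M :: "'y topology"
  assumes M: "universal_minimal_flow (G :: ('g, 'm) monoid_scheme) T M \<mu>" and T: "topspace T = carrier G"
    and X: "minimal_flow G T X \<phi>"
  shows "\<exists>f. G_map G M \<mu> X \<phi> f \<and> f ` topspace M = topspace X"
proof -
  have M': "flow G T M \<mu>" and F: "flow G T X \<phi>"
    using M X by (auto simp: universal_minimal_flow_def minimal_flow_def)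
  obtain e :: "'x \<Rightarrow> 'g flow_point" where "inj_on e (topspace X)"
    using minimal_flow_inj[OF X T] by blast
  then obtain Y \<psi> where Y: "flow G T Y \<psi>" "G_map G X \<phi> Y \<psi> e" "homeomorphic_map X Y e"
    "topspace Y = e ` topspace X"
    by (rule flow_transfer[OF F T])
  then have "minimal_flow G T Y \<psi>"
    using minimal_image[OF X] by metis
  then obtain f where f: "G_map G M \<mu> Y \<psi> f"
    using M unfolding universal_minimal_flow_def by blast
  obtain e' where e': "homeomorphic_maps X Y e e'"
    using Y(3) homeomorphic_map_maps by blast
  have "G_map G M \<mu> X \<phi> (e' \<circ> f)"
    unfolding G_map_def
  proof (intro conjI ballI)
    show "continuous_map M X (e' \<circ> f)"
      using f e' by (auto simp: G_map_def homeomorphic_maps_def intro: continuous_map_compose)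
    fix g m assume gm: "g \<in> carrier G" "m \<in> topspace M"
    then have fm: "f m \<in> topspace Y" "f (\<mu> g m) = \<psi> g (f m)"
      using f by (auto simp: G_map_def continuous_map_def)
    then have x: "e' (f m) \<in> topspace X" "e (e' (f m)) = f m"
      using e' by (auto simp: homeomorphic_maps_def continuous_map_def)
    then have "\<psi> g (f m) = e (\<phi> g (e' (f m)))"
      using Y(2) gm by (auto simp: G_map_def)
    then show "(e' \<circ> f) (\<mu> g m) = \<phi> g ((e' \<circ> f) m)"
      using e' fm x flow_closed[OF F gm(1)] by (auto simp: homeomorphic_maps_def)
  qed
  then show ?thesis using minimal_map_surj[OF M' X] by blast
qed

text \<open>If \<open>x\<close> were a limit of almost periodic points without being one, a Urysohn function \<open>u\<close> would
  separate it from a subflow of its orbit closure. The factor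
  \<open>y \<mapsto> (\<lambda>g. u (g y))\<close> of the flow retains this failure and lives in \<open>'g \<Rightarrow> real\<close>.\<close>

lemma CAP_closedin_AP:
  fixes X :: "'x topology"
  assumes G: "CAP (G :: ('g, 'm) monoid_scheme) T" and X: "flow G T X \<phi>"
  shows "closedin X (AP G T X \<phi>)"
proof -
  have T: "topspace T = carrier G" using G by (simp add: CAP_def topological_group_def)
  have sub: "AP G T X \<phi> \<subseteq> topspace X" by (auto simp: AP_def)
  have "X closure_of AP G T X \<phi> \<subseteq> AP G T X \<phi>"
  proof
    fix x assume xcl: "x \<in> X closure_of AP G T X \<phi>"
    then have x: "x \<in> topspace X" using closure_of_subset_topspace by fastforce
    let ?C = "X closure_of orbit G \<phi> x"
    show "x \<in> AP G T X \<phi>"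
    proof (rule ccontr)
      assume "x \<notin> AP G T X \<phi>"
      then obtain Z where Z: "subflow G X \<phi> Z" "Z \<subseteq> ?C" "Z \<noteq> ?C"
        using x by (auto simp: AP_iff[OF X T])
      then have "x \<notin> Z" using subflow_closure_subset by fastforce
      have "normal_space X" "closedin X Z" "closedin X {x}"
        using X Z x by (auto simp: flow_def subflow_def closedin_Hausdorff_singleton
            compact_Hausdorff_or_regular_imp_normal_space)
      then obtain u :: "'x \<Rightarrow> real" where u: "continuous_map X (top_of_set {0..1}) u" "u ` Z \<subseteq> {0}" "u ` {x} \<subseteq> {1}"
        using \<open>x \<notin> Z\<close> by (elim Urysohn_lemma[of X Z "{x}" 0 1]) auto
      then have ucont: "continuous_map X euclideanreal u"
        by (simp add: continuous_map_in_subtopology)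
      define p where "p y = (\<lambda>g\<in>carrier G. u (\<phi> g y))" for y
      let ?R = "product_topology (\<lambda>_. euclideanreal) (carrier G)"
      have pcont: "continuous_map X ?R p"
        unfolding continuous_map_componentwise
      proof (intro conjI ballI)
        fix g assume g: "g \<in> carrier G"
        have "continuous_map X euclideanreal (u \<circ> \<phi> g)"
          using flow_continuous[OF X T g] ucont by (rule continuous_map_compose)
        then show "continuous_map X euclideanreal (\<lambda>y. p y g)"
          using g by (simp add: p_def comp_def)
      qed (auto simp: p_def)
      define Y where "Y = subtopology ?R (p ` topspace X)"
      have "p ` topspace X \<subseteq> topspace ?R" by (auto simp: p_def)
      then have topY: "topspace Y = p ` topspace X" by (auto simp: Y_def)
      have p: "continuous_map X Y p" "p ` topspace X = topspace Y"
        using pcont topY by (auto simp: Y_def continuous_map_in_subtopology)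
      have Y: "Hausdorff_space Y"
        by (simp add: Y_def Hausdorff_space_subtopology Hausdorff_space_product_topology)
      interpret group G using X by (rule flow_group)
      have "p (\<phi> g y) = p (\<phi> g z)"
        if "g \<in> carrier G" "y \<in> topspace X" "z \<in> topspace X" "p y = p z" for g y z
      proof -
        have "u (\<phi> h (\<phi> g y)) = u (\<phi> h (\<phi> g z))" if "h \<in> carrier G" for h
        proof -
          have "p y (h \<otimes>\<^bsub>G\<^esub> g) = p z (h \<otimes>\<^bsub>G\<^esub> g)" using \<open>p y = p z\<close> by simp
          then show ?thesis
            using that \<open>g \<in> carrier G\<close> \<open>y \<in> topspace X\<close> \<open>z \<in> topspace X\<close>
            by (simp add: p_def flow_mult[OF X])
        qed
        then show ?thesis by (auto simp: p_def)
      qed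
      then obtain \<psi> where \<psi>: "flow G T Y \<psi>" "G_map G X \<phi> Y \<psi> p"
        using flow_factor[OF X T Y p] by blast
      obtain W \<omega> where W: "flow G T W \<omega>" "G_map G Y \<psi> W \<omega> (\<lambda>q. {q})"
        by (rule flow_transfer[OF \<psi>(1) T, of "\<lambda>q. {q}"]) auto
      define r where "r = (\<lambda>y. {p y})"
      have r: "G_map G X \<phi> W \<omega> r"
        unfolding G_map_def
      proof (intro conjI ballI)
        show "continuous_map X W r"
          using \<psi>(2) W(2) continuous_map_compose[of X Y p W "\<lambda>q. {q}"]
          by (simp add: G_map_def r_def comp_def)
        show "r (\<phi> g y) = \<omega> g (r y)" if "g \<in> carrier G" "y \<in> topspace X" for g y
        proof -
          have "p y \<in> topspace Y" using that(2) p(2) by blast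
          then show ?thesis using that \<psi>(2) W(2) by (simp add: G_map_def r_def)
        qed
      qed
      have "closedin W (AP G T W \<omega>)"
        using G W(1) by (simp add: CAP_def)
      moreover have "r ` AP G T X \<phi> \<subseteq> AP G T W \<omega>"
        using AP_image[OF X T W(1) r] by auto
      moreover have "r x \<in> W closure_of (r ` AP G T X \<phi>)"
        using r xcl continuous_map_image_closure_subset by (fastforce simp: G_map_def)
      ultimately have "r x \<in> AP G T W \<omega>"
        using closure_of_minimal by blast
      moreover have WH: "Hausdorff_space W" using W(1) by (simp add: flow_def)
      have "subflow G W \<omega> (r ` Z)" "r ` Z \<subseteq> W closure_of orbit G \<omega> (r x)"
        using subflow_image[OF X WH r Z(1)] image_orbit_closure[OF X T WH r x] Z(2) by auto
      ultimately have "r ` Z = W closure_of orbit G \<omega> (r x)"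
        by (simp add: AP_iff[OF W(1) T])
      also have "\<dots> = r ` ?C" using image_orbit_closure[OF X T WH r x] by simp
      finally have "r x \<in> r ` Z" using subflow_orbit_closure(2)[OF X T x] by auto
      then obtain z where z: "z \<in> Z" "p x = p z" by (auto simp: r_def)
      then have "z \<in> topspace X" using \<open>closedin X Z\<close> closedin_subset by blast
      have "p x \<one>\<^bsub>G\<^esub> = p z \<one>\<^bsub>G\<^esub>" using z by simp
      then have "u x = u z" using x \<open>z \<in> topspace X\<close> by (simp add: p_def flow_one[OF X])
      then show False using u z by auto
    qed
  qed
  then show ?thesis
    using sub closure_of_subset_eq by blast
qed

lemma flow_pullback:
  assumes X: "flow G T X \<phi>" and "group H" and h: "h \<in> hom H G" "continuous_map S T h"
  shows "flow H S X (\<lambda>g. \<phi> (h g))"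
proof -
  have "group_hom G (BijGroup (topspace X)) \<phi>"
    using X by (simp add: flow_def group_action_def)
  then have "(\<phi> \<circ> h) \<in> hom H (BijGroup (topspace X))"
    using h by (auto simp: group_hom_def group_hom_axioms_def intro: Group.hom_compose)
  then have "group_action H (topspace X) (\<lambda>g. \<phi> (h g))"
    using \<open>group H\<close>
    by (simp add: group_action_def group_hom_def group_hom_axioms_def group_BijGroup comp_def)
  moreover have "continuous_map (prod_topology S X) X (\<lambda>(g, x). \<phi> (h g) x)"
  proof -
    have "continuous_map (prod_topology S X) X ((\<lambda>(g, x). \<phi> g x) \<circ> (\<lambda>(g, x). (h g, x)))"
      using X h(2) continuous_map_prod_top[of S X T X h "\<lambda>x. x"]
      by (intro continuous_map_compose) (auto simp: flow_def)
    then show ?thesis by (rule continuous_map_eq) auto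
  qed
  ultimately show ?thesis using X by (simp add: flow_def)
qed

lemma flow_product:
  assumes X: "\<And>i. i \<in> I \<Longrightarrow> flow (G i) (T i) (X i) (\<phi> i)"
  shows "flow (product_group I G) (product_topology T I) (product_topology X I) (product_action I X \<phi>)"
  unfolding flow_def
proof (intro conjI)
  show "topspace (product_topology X I) \<noteq> {}"
    using X unfolding flow_def topspace_product_topology comp_def PiE_eq_empty_iff by blast
  show "compact_space (product_topology X I)" "Hausdorff_space (product_topology X I)"
    using X by (auto simp: compact_space_product_topology Hausdorff_space_product_topology flow_def)
  show "group_action (product_group I G) (topspace (product_topology X I)) (product_action I X \<phi>)"
  proof (rule group_actionI)
    show "group (product_group I G)"
      using X by (auto intro: product_group flow_group)
    show "product_action I X \<phi> g \<in> extensional (topspace (product_topology X I))" for g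
      by (simp add: product_action_def)
    show "product_action I X \<phi> g x \<in> topspace (product_topology X I)"
      if "g \<in> carrier (product_group I G)" "x \<in> topspace (product_topology X I)" for g x
      using that X flow_closed by (fastforce simp: product_action_def PiE_iff)
    show "product_action I X \<phi> \<one>\<^bsub>product_group I G\<^esub> x = x"
      if "x \<in> topspace (product_topology X I)" for x
      using that flow_one[OF X] by (auto simp: product_action_def PiE_iff extensional_def fun_eq_iff)
    show "product_action I X \<phi> (g \<otimes>\<^bsub>product_group I G\<^esub> h) x =
            product_action I X \<phi> g (product_action I X \<phi> h x)"
      if "g \<in> carrier (product_group I G)" "h \<in> carrier (product_group I G)"
        "x \<in> topspace (product_topology X I)" for g h x
      using that flow_mult[OF X] flow_closed[OF X]
      by (auto simp: product_action_def PiE_iff fun_eq_iff)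
  qed
  show "continuous_map (prod_topology (product_topology T I) (product_topology X I))
          (product_topology X I) (\<lambda>(g, x). product_action I X \<phi> g x)"
  proof -
    let ?P = "prod_topology (product_topology T I) (product_topology X I)"
    have cm: "continuous_map ?P (X i) (\<lambda>(g, x). \<phi> i (g i) (x i))" if i: "i \<in> I" for i
    proof -
      have "continuous_map ?P (prod_topology (T i) (X i)) (\<lambda>(g, x). (g i, x i))"
        using i continuous_map_prod_top[of "product_topology T I" "product_topology X I" "T i" "X i"
            "\<lambda>g. g i" "\<lambda>x. x i"]
        by (simp add: continuous_map_product_projection)
      then have "continuous_map ?P (X i) ((\<lambda>(g, x). \<phi> i g x) \<circ> (\<lambda>(g, x). (g i, x i)))"
        using X[OF i] by (meson continuous_map_compose flow_def)
      then show ?thesis by (rule continuous_map_eq) auto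
    qed
    have "continuous_map ?P (product_topology X I) (\<lambda>gx. \<lambda>i\<in>I. \<phi> i (fst gx i) (snd gx i))"
      using cm by (auto simp: continuous_map_componentwise case_prod_unfold)
    then show ?thesis
      by (rule continuous_map_eq) (auto simp: product_action_def)
  qed
qed

lemma flow_prod:
  assumes X: "flow H S X \<phi>" and Y: "flow K T Y \<psi>"
  shows "flow (H \<times>\<times> K) (prod_topology S T) (prod_topology X Y) (prod_action X \<phi> Y \<psi>)"
  unfolding flow_def
proof (intro conjI)
  show "topspace (prod_topology X Y) \<noteq> {}"
    using X Y unfolding flow_def topspace_prod_topology by blast
  show "compact_space (prod_topology X Y)" "Hausdorff_space (prod_topology X Y)"
    using X Y by (auto simp: compact_space_prod_topology Hausdorff_space_prod_topology flow_def)
  show "group_action (H \<times>\<times> K) (topspace (prod_topology X Y)) (prod_action X \<phi> Y \<psi>)"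
  proof (rule group_actionI)
    show "group (H \<times>\<times> K)"
      using X Y by (auto intro: DirProd_group flow_group)
  qed (auto simp: prod_action_def flow_closed[OF X] flow_closed[OF Y] flow_one[OF X] flow_one[OF Y]
        flow_mult[OF X] flow_mult[OF Y])
  show "continuous_map (prod_topology (prod_topology S T) (prod_topology X Y)) (prod_topology X Y)
          (\<lambda>(g, x). prod_action X \<phi> Y \<psi> g x)"
  proof -
    let ?P = "prod_topology (prod_topology S T) (prod_topology X Y)"
    have "continuous_map ?P (prod_topology S X) (\<lambda>p. (fst (fst p), fst (snd p)))"
      "continuous_map ?P (prod_topology T Y) (\<lambda>p. (snd (fst p), snd (snd p)))"
      by (intro continuous_map_pairedI
          continuous_map_compose[OF continuous_map_fst continuous_map_fst, unfolded comp_def]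
          continuous_map_compose[OF continuous_map_fst continuous_map_snd, unfolded comp_def]
          continuous_map_compose[OF continuous_map_snd continuous_map_fst, unfolded comp_def]
          continuous_map_compose[OF continuous_map_snd continuous_map_snd, unfolded comp_def])+
    then have "continuous_map ?P X ((\<lambda>(g, x). \<phi> g x) \<circ> (\<lambda>p. (fst (fst p), fst (snd p))))"
      "continuous_map ?P Y ((\<lambda>(g, x). \<psi> g x) \<circ> (\<lambda>p. (snd (fst p), snd (snd p))))"
      using X Y by (meson continuous_map_compose flow_def)+
    then have "continuous_map ?P (prod_topology X Y)
        (\<lambda>p. (\<phi> (fst (fst p)) (fst (snd p)), \<psi> (snd (fst p)) (snd (snd p))))"
      by (auto simp: comp_def intro: continuous_map_pairedI)
    then show ?thesis
      by (rule continuous_map_eq) (auto simp: prod_action_def)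
  qed
qed

lemma minimal_subflow_exists:
  assumes X: "flow G T X \<phi>"
  obtains Y where "subflow G X \<phi> Y" "\<And>Z. subflow G X \<phi> Z \<Longrightarrow> Z \<subseteq> Y \<Longrightarrow> Z = Y"
proof -
  define \<A> where "\<A> = {W. W \<subseteq> topspace X \<and> subflow G X \<phi> (topspace X - W)}"
  have "\<exists>M\<in>\<A>. \<forall>W\<in>\<A>. M \<subseteq> W \<longrightarrow> W = M"
  proof (rule subset_Zorn_nonempty)
    have "{} \<in> \<A>" using X by (auto simp: \<A>_def subflow_def flow_closed flow_def)
    then show "\<A> \<noteq> {}" by blast
  next
    fix \<C> assume C: "\<C> \<noteq> {}" "subset.chain \<A> \<C>"
    let ?U = "(\<lambda>W. topspace X - W) ` \<C>"
    have sub: "subflow G X \<phi> (topspace X - W)" if "W \<in> \<C>" for W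
      using C that by (auto simp: \<A>_def subset_chain_def)
    have fip: "\<Inter>F \<noteq> {}" if F: "finite F" "F \<subseteq> ?U" for F
    proof (cases "F = {}")
      case False
      have "D \<subseteq> E \<or> E \<subseteq> D" if DE: "D \<in> F" "E \<in> F" for D E
      proof -
        obtain V W where "V \<in> \<C>" "W \<in> \<C>" "D = topspace X - V" "E = topspace X - W"
          using DE F(2) by blast
        moreover have "V \<subseteq> W \<or> W \<subseteq> V"
          using C(2) calculation(1,2) unfolding subset_chain_def by blast
        ultimately show ?thesis by blast
      qed
      moreover obtain D where D: "D \<in> F" "\<And>E. E \<in> F \<Longrightarrow> E \<subseteq> D \<Longrightarrow> E = D"
        using finite_has_minimal[OF F(1) False] by blast
      ultimately have "D \<subseteq> E" if "E \<in> F" for E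
        using that by blast
      moreover have "D \<noteq> {}"
        using D(1) F(2) sub by (auto simp: subflow_def)
      ultimately show ?thesis by blast
    qed simp
    have clo: "\<forall>D\<in>?U. closedin X D" using sub by (auto simp: subflow_def)
    have "compact_space X" using X by (simp add: flow_def)
    from iffD1[OF compact_space_fip this, THEN spec, of ?U] clo fip
    have ne: "\<Inter>?U \<noteq> {}" by presburger
    have eq: "topspace X - \<Union>\<C> = \<Inter>?U" using C(1) by auto
    have "closedin X (\<Inter>?U)"
      using C(1) sub by (intro closedin_Inter) (auto simp: subflow_def)
    then have "subflow G X \<phi> (\<Inter>?U)"
      unfolding subflow_def using ne sub by (auto simp: subflow_def flow_closed[OF X])
    moreover have "\<Union>\<C> \<subseteq> topspace X"
      using C(2) unfolding subset_chain_def \<A>_def by blast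
    ultimately show "\<Union>\<C> \<in> \<A>"
      unfolding \<A>_def mem_Collect_eq eq by (rule conjI[rotated])
  qed
  then obtain M where M: "M \<in> \<A>" "\<And>W. W \<in> \<A> \<Longrightarrow> M \<subseteq> W \<Longrightarrow> W = M" by blast
  have "Z = topspace X - M" if Z: "subflow G X \<phi> Z" "Z \<subseteq> topspace X - M" for Z
  proof -
    have "Z \<subseteq> topspace X" using Z by blast
    then have "topspace X - (topspace X - Z) = Z" by blast
    then have "topspace X - Z \<in> \<A>" "M \<subseteq> topspace X - Z"
      using Z M(1) by (auto simp: \<A>_def)
    then have "topspace X - Z = M" using M(2) by blast
    then show ?thesis using \<open>Z \<subseteq> topspace X\<close> by blast
  qed
  then show ?thesis using that M(1) by (auto simp: \<A>_def)
qed

lemma universal_minimal_flow_exists: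
  fixes G :: "('g, 'm) monoid_scheme"
  assumes G: "group G" "topspace T = carrier G"
  obtains M :: "'g flow_point topology" and \<mu> where "universal_minimal_flow G T M \<mu>"
proof -
  define J :: "('g flow_point topology \<times> ('g \<Rightarrow> 'g flow_point \<Rightarrow> 'g flow_point)) set"
    where "J = {(X, \<phi>). minimal_flow G T X \<phi>}"
  let ?X = "product_topology fst J"
  define \<xi> where "\<xi> g = product_action J fst snd (\<lambda>j\<in>J. g)" for g
  have "flow (product_group J (\<lambda>_. G)) (product_topology (\<lambda>_. T) J) ?X (product_action J fst snd)"
    by (rule flow_product) (auto simp: J_def minimal_flow_def)
  moreover have "(\<lambda>g. \<lambda>j\<in>J. g) \<in> hom G (product_group J (\<lambda>_. G))"
    by (auto simp: hom_def fun_eq_iff)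
  moreover have "continuous_map T (product_topology (\<lambda>_. T) J) (\<lambda>g. \<lambda>j\<in>J. g)"
    by (auto simp: continuous_map_componentwise)
  ultimately have X: "flow G T ?X \<xi>"
    unfolding \<xi>_def by (rule flow_pullback[OF _ G(1)])
  obtain Y where Y: "subflow G ?X \<xi> Y" "\<And>Z. subflow G ?X \<xi> Z \<Longrightarrow> Z \<subseteq> Y \<Longrightarrow> Z = Y"
    using minimal_subflow_exists[OF X] by blast
  define N where "N = subtopology ?X Y"
  define \<nu> where "\<nu> g = restrict (\<xi> g) Y" for g
  have N: "minimal_flow G T N \<nu>"
    unfolding N_def \<nu>_def using minimal_flow_restrict_iff[OF X G(2) Y(1)] Y(2) by blast
  then have N': "flow G T N \<nu>" by (simp add: minimal_flow_def)
  have Ysub: "Y \<subseteq> topspace ?X" using Y(1) unfolding subflow_def by (meson closedin_subset)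
  then have topN: "topspace N = Y" unfolding N_def by (rule topspace_subtopology_subset)
  obtain e :: "_ \<Rightarrow> 'g flow_point" where "inj_on e (topspace N)"
    using minimal_flow_inj[OF N G(2)] by blast
  then obtain M \<mu> where M: "flow G T M \<mu>" "G_map G N \<nu> M \<mu> e" "homeomorphic_map N M e"
    "topspace M = e ` topspace N"
    by (rule flow_transfer[OF N' G(2)])
  then have min: "minimal_flow G T M \<mu>"
    using minimal_image[OF N] by metis
  obtain e' where e': "homeomorphic_maps N M e e'"
    using M(3) homeomorphic_map_maps by blast
  have "\<exists>f. G_map G M \<mu> Z \<zeta> f" if Z: "minimal_flow G T Z \<zeta>"
    for Z :: "'g flow_point topology" and \<zeta>
  proof -
    have j: "(Z, \<zeta>) \<in> J" using Z by (simp add: J_def)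
    have "G_map G M \<mu> Z \<zeta> (\<lambda>m. e' m (Z, \<zeta>))"
      unfolding G_map_def
    proof (intro conjI ballI)
      have "continuous_map N Z (\<lambda>x. x (Z, \<zeta>))"
        using continuous_map_product_projection[OF j, of fst]
        by (auto simp: N_def intro: continuous_map_from_subtopology)
      then have "continuous_map M Z ((\<lambda>x. x (Z, \<zeta>)) \<circ> e')"
        using e' by (auto simp: homeomorphic_maps_def intro: continuous_map_compose)
      then show "continuous_map M Z (\<lambda>m. e' m (Z, \<zeta>))" by (simp add: comp_def)
      fix g m assume gm: "g \<in> carrier G" "m \<in> topspace M"
      then obtain y where y: "y \<in> Y" "m = e y" using M(4) topN by auto
      then have "\<mu> g m = e (\<nu> g y)" "\<nu> g y \<in> Y"
        using M(2) gm topN flow_closed[OF N'] by (auto simp: G_map_def)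
      then have "e' (\<mu> g m) = \<nu> g y" "e' m = y"
        using e' y topN by (auto simp: homeomorphic_maps_def)
      then show "e' (\<mu> g m) (Z, \<zeta>) = \<zeta> g (e' m (Z, \<zeta>))"
        using y Ysub j by (auto simp: \<nu>_def \<xi>_def product_action_def)
    qed
    then show ?thesis by blast
  qed
  then have "universal_minimal_flow G T M \<mu>"
    unfolding universal_minimal_flow_def by (metis min minimal_map_surj[OF M(1)])
  then show ?thesis by (rule that)
qed

end

theory Submission
  imports Defs
begin

text \<open>
  A map from the universal minimal flow of a product onto the product of the universal minimal flows
  exists because a product of minimal flows is minimal. The point is that it is injective.

  For two factors \<open>H\<close> and \<open>K\<close>, with \<open>H\<close> CAP, let \<open>\<pi>\<close> be its first coordinate, a map onto \<open>M(H)\<close>. It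
  suffices that each fibre of \<open>\<pi>\<close> is the closure of a \<open>K\<close>-orbit (\<open>CAP_fibre_in_orbit_closure\<close>): such
  fibres are minimal \<open>K\<close>-flows, and a map from a minimal flow to the universal one is injective
  (\<open>minimal_flow_onto_universal_inj\<close>), because all endomorphisms of a universal minimal flow are
  injective (\<open>universal_minimal_flow_endomorphism_inj\<close>, proved with idempotents of the enveloping
  semigroup). To describe the fibres, one parametrises the flow by the \<open>H\<close>-maps from \<open>M(H)\<close> to it. This
  needs compactness: the set of these maps must be closed in the topology of pointwise convergence,
  and evaluation must be jointly continuous on it.

  Both follow from equicontinuity of the \<open>H\<close>-maps, which is the consequence of CAP that the proof
  rests on (\<open>CAP_dominating_function\<close>, \<open>CAP_equicontinuous_maps\<close>). The supremum \<open>d\<close> of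
  their oscillations about a point \<open>w\<close> is a priori not continuous on \<open>M(H)\<close>, but its restriction to the orbit of
  \<open>w\<close> is a limit of almost periodic points in a flow of functions. By CAP this limit is almost periodic. The
  orbit closure that it generates together with \<open>w\<close> is minimal, so it projects homeomorphically to \<open>M(H)\<close>.
  This yields a continuous function that vanishes at \<open>w\<close> and dominates every single oscillation.

  For infinitely many CAP factors the description of fibres is iterated over finite sets of
  coordinates (\<open>CAP_product_fibre\<close>). That is enough, as a continuous function is almost invariant under
  the partial product over all but finitely many factors.
\<close>

section \<open>Subflows, maps of flows and powers of a flow\<close>

lemma subflow_subset_topspace: "subflow G X \<phi> Y \<Longrightarrow> Y \<subseteq> topspace X"
  by (simp add: subflow_def closedin_subset)

lemma minimal_subflow_within:
  assumes X: "flow G T X \<phi>" and T: "topspace T = carrier G" and Y: "subflow G X \<phi> Y"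
  obtains Z where "subflow G X \<phi> Z" "Z \<subseteq> Y" "\<And>W. subflow G X \<phi> W \<Longrightarrow> W \<subseteq> Z \<Longrightarrow> W = Z"
proof -
  have "closedin X Y" using Y by (simp add: subflow_def)
  note iff = subflow_restrict_iff[OF this, of G \<phi>]
  obtain Z where Z: "subflow G (subtopology X Y) (\<lambda>g. restrict (\<phi> g) Y) Z"
    "\<And>W. subflow G (subtopology X Y) (\<lambda>g. restrict (\<phi> g) Y) W \<Longrightarrow> W \<subseteq> Z \<Longrightarrow> W = Z"
    using minimal_subflow_exists[OF flow_restrict[OF X T Y]] by blast
  then show ?thesis
    using that[of Z] by (metis iff subset_trans)
qed

lemma G_map_compose:
  assumes "G_map G X \<phi> Y \<psi> f" "G_map G Y \<psi> Z \<zeta> g"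
  shows "G_map G X \<phi> Z \<zeta> (g \<circ> f)"
proof -
  have "f x \<in> topspace Y" if "x \<in> topspace X" for x
    using assms(1) that continuous_map_image_subset_topspace unfolding G_map_def by fast
  moreover have "continuous_map X Z (g \<circ> f)"
    using assms by (auto simp: G_map_def intro: continuous_map_compose)
  ultimately show ?thesis
    using assms by (simp add: G_map_def)
qed

lemma G_map_from_restrict:
  assumes f: "G_map G X \<phi> Y \<psi> f"
  shows "G_map G (subtopology X Z) (\<lambda>g. restrict (\<phi> g) Z) Y \<psi> f"
  using f by (auto simp: G_map_def continuous_map_from_subtopology)

lemma G_map_into_restrict:
  assumes "G_map G X \<phi> (subtopology Y Z) (\<lambda>g. restrict (\<psi> g) Z) f"
  shows "G_map G X \<phi> Y \<psi> f" "f ` topspace X \<subseteq> Z"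
  using assms by (auto simp: G_map_def continuous_map_in_subtopology image_subset_iff Pi_iff)

text \<open>The diagonal action on a power \<open>X\<^sup>S\<close>. It serves twice: for \<open>S = X\<close> the orbit closure of the
  identity is the enveloping semigroup of \<open>X\<close>, and for \<open>S = M(H)\<close> it makes the \<open>H\<close>-maps
  \<open>M(H) \<rightarrow> X\<close> into a flow of any group that commutes with \<open>H\<close>.\<close>

definition power_action ::
  "'s set \<Rightarrow> 'x topology \<Rightarrow> ('g \<Rightarrow> 'x \<Rightarrow> 'x) \<Rightarrow> 'g \<Rightarrow> ('s \<Rightarrow> 'x) \<Rightarrow> ('s \<Rightarrow> 'x)" where
  "power_action S X \<phi> g = product_action S (\<lambda>_. X) (\<lambda>_. \<phi>) (\<lambda>_\<in>S. g)"

lemma power_action_apply: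
  "p \<in> topspace (product_topology (\<lambda>_. X) S) \<Longrightarrow> power_action S X \<phi> g p = (\<lambda>s\<in>S. \<phi> g (p s))"
  by (auto simp: power_action_def product_action_def fun_eq_iff)

lemma flow_power:
  assumes "flow G T X \<phi>"
  shows "flow G T (product_topology (\<lambda>_. X) S) (power_action S X \<phi>)"
proof -
  have "flow (product_group S (\<lambda>_. G)) (product_topology (\<lambda>_. T) S)
          (product_topology (\<lambda>_. X) S) (product_action S (\<lambda>_. X) (\<lambda>_. \<phi>))"
    by (rule flow_product) (rule assms)
  moreover have "(\<lambda>g. \<lambda>_\<in>S. g) \<in> hom G (product_group S (\<lambda>_. G))"
    by (auto simp: hom_def fun_eq_iff)
  moreover have "continuous_map T (product_topology (\<lambda>_. T) S) (\<lambda>g. \<lambda>_\<in>S. g)"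
    by (auto simp: continuous_map_componentwise)
  ultimately show ?thesis
    unfolding power_action_def by (rule flow_pullback[OF _ flow_group[OF assms]])
qed

lemma G_map_evaluation:
  "s \<in> S \<Longrightarrow> G_map G (product_topology (\<lambda>_. X) S) (power_action S X \<phi>) X \<phi> (\<lambda>p. p s)"
  using continuous_map_product_projection[of s S "\<lambda>_. X"]
  by (auto simp: G_map_def power_action_apply)

section \<open>Universal minimal flows are coalescent\<close>

text \<open>Zorn's lemma for reverse inclusion: by compactness the intersection of a chain of non-empty closed
  sets is again non-empty, so only closure under intersections has to be supplied.\<close>

lemma compact_space_minimal_closed_subset:
  assumes X: "compact_space X" and A: "A \<in> \<A>"
    and clo: "\<And>B. B \<in> \<A> \<Longrightarrow> closedin X B \<and> B \<noteq> {}"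
    and inter: "\<And>\<C>. \<C> \<noteq> {} \<Longrightarrow> \<C> \<subseteq> \<A> \<Longrightarrow> \<Inter>\<C> \<noteq> {} \<Longrightarrow> \<Inter>\<C> \<in> \<A>"
  obtains B where "B \<in> \<A>" "\<And>D. D \<in> \<A> \<Longrightarrow> D \<subseteq> B \<Longrightarrow> D = B"
proof -
  have "\<exists>B\<in>\<A>. \<forall>D\<in>\<A>. B \<supseteq> D \<longrightarrow> D = B"
  proof (rule predicate_Zorn)
    show "partial_order_on \<A> (relation_of (\<supseteq>) \<A>)"
      by (rule partial_order_on_relation_ofI) auto
    fix \<C> assume C: "\<C> \<in> Chains (relation_of (\<supseteq>) \<A>)"
    then have sub: "\<C> \<subseteq> \<A>" by (auto simp: Chains_def relation_of_def)
    have lin: "D \<subseteq> E \<or> E \<subseteq> D" if "D \<in> \<C>" "E \<in> \<C>" for D E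
      using C that by (auto simp: Chains_def relation_of_def)
    show "\<exists>U\<in>\<A>. \<forall>D\<in>\<C>. D \<supseteq> U"
    proof (cases "\<C> = {}")
      case False
      have fip: "\<Inter>F \<noteq> {}" if F: "finite F" "F \<subseteq> \<C>" for F
      proof (cases "F = {}")
        case nonempty: False
        obtain D where D: "D \<in> F" "\<And>E. E \<in> F \<Longrightarrow> E \<subseteq> D \<Longrightarrow> E = D"
          using finite_has_minimal[OF F(1) nonempty] by blast
        then have "D \<subseteq> E" if "E \<in> F" for E
          using that lin F(2) by blast
        then show ?thesis using D(1) F(2) sub clo by blast
      qed simp
      have "\<forall>D\<in>\<C>. closedin X D" using sub clo by blast
      then have "\<Inter>\<C> \<noteq> {}"
        using X[unfolded compact_space_fip, rule_format, of \<C>] fip by presburger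
      then have "\<Inter>\<C> \<in> \<A>" using inter False sub by blast
      then show ?thesis by blast
    qed (use A in blast)
  qed
  then show ?thesis using that by blast
qed

text \<open>The Ellis--Numakura lemma. In a minimal closed subsemigroup \<open>B\<close> with an element \<open>v\<close>, the
  subsemigroup \<open>B v\<close> is all of \<open>B\<close>, so the closed subsemigroup of all \<open>p\<close> with \<open>p v = v\<close> is
  non-empty, hence all of \<open>B\<close>, and therefore contains \<open>v\<close>.\<close>

lemma compact_right_topological_semigroup_idempotent:
  assumes X: "compact_space X" "Hausdorff_space X" "topspace X \<noteq> {}"
    and cl: "\<And>p q. p \<in> topspace X \<Longrightarrow> q \<in> topspace X \<Longrightarrow> m p q \<in> topspace X"
    and assoc: "\<And>p q r. p \<in> topspace X \<Longrightarrow> q \<in> topspace X \<Longrightarrow> r \<in> topspace X \<Longrightarrow>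
                 m (m p q) r = m p (m q r)"
    and cont: "\<And>q. q \<in> topspace X \<Longrightarrow> continuous_map X X (\<lambda>p. m p q)"
  obtains e where "e \<in> topspace X" "m e e = e"
proof -
  define \<A> where "\<A> = {B. closedin X B \<and> B \<noteq> {} \<and> (\<forall>p\<in>B. \<forall>q\<in>B. m p q \<in> B)}"
  have "topspace X \<in> \<A>" using X cl by (auto simp: \<A>_def)
  then obtain B where B: "B \<in> \<A>" and min: "\<And>D. D \<in> \<A> \<Longrightarrow> D \<subseteq> B \<Longrightarrow> D = B"
  proof (rule compact_space_minimal_closed_subset[OF X(1)])
    show "closedin X B \<and> B \<noteq> {}" if "B \<in> \<A>" for B using that by (auto simp: \<A>_def)
    show "\<Inter>\<C> \<in> \<A>" if "\<C> \<noteq> {}" "\<C> \<subseteq> \<A>" "\<Inter>\<C> \<noteq> {}" for \<C>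
      unfolding \<A>_def mem_Collect_eq
    proof (intro conjI ballI)
      show "closedin X (\<Inter>\<C>)" using that by (intro closedin_Inter) (auto simp: \<A>_def)
      show "m p q \<in> \<Inter>\<C>" if "p \<in> \<Inter>\<C>" "q \<in> \<Inter>\<C>" for p q
        using that \<open>\<C> \<subseteq> \<A>\<close> by (auto simp: \<A>_def)
    qed fact
  qed blast
  have clB: "closedin X B" "B \<subseteq> topspace X" and mB: "\<And>p q. p \<in> B \<Longrightarrow> q \<in> B \<Longrightarrow> m p q \<in> B"
    using B closedin_subset by (auto simp: \<A>_def)
  obtain v where v: "v \<in> B" using B by (auto simp: \<A>_def)
  then have vX: "v \<in> topspace X" using clB by blast
  have "compactin X B" using X(1) clB(1) by (simp add: closedin_compact_space)
  then have "closedin X ((\<lambda>p. m p v) ` B)"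
    using image_compactin[OF _ cont[OF vX]] compactin_imp_closedin[OF X(2)] by blast
  moreover have "m p v \<in> B" if "p \<in> B" for p using that v mB by blast
  ultimately have "(\<lambda>p. m p v) ` B \<in> \<A>"
    unfolding \<A>_def using v by (auto simp: assoc[symmetric] subsetD[OF clB(2)] mB)
  then have "(\<lambda>p. m p v) ` B = B" by (rule min) (use v mB in auto)
  then obtain u where u: "u \<in> B" "m u v = v" using v by (metis imageE)
  let ?D = "{p \<in> B. m p v \<in> {v}}"
  have "closedin X ?D"
    using cont[OF vX] clB(1) X(2) vX
    by (intro closedin_continuous_map_preimage_gen) (auto simp: closedin_Hausdorff_singleton)
  moreover have "m p q \<in> ?D" if "p \<in> ?D" "q \<in> ?D" for p q
    using that assoc[of p q v] mB clB(2) vX by auto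
  ultimately have "?D \<in> \<A>" unfolding \<A>_def using u by blast
  then have "?D = B" by (rule min) blast
  then have "m v v = v" using v by blast
  then show ?thesis using that vX by blast
qed

text \<open>The enveloping semigroup \<open>E\<close> of \<open>M\<close> is a semigroup of maps under composition whose subflows are its
  closed left ideals. A minimal one, \<open>L\<close>, is a minimal flow. An endomorphism \<open>\<kappa>\<close> of \<open>L\<close> commutes with
  left multiplication, and an idempotent \<open>e \<in> L\<close> is a right unit of \<open>L\<close>; so \<open>\<kappa> p = \<kappa> (p e) = p v\<close> with
  \<open>v = \<kappa> e\<close>. Since \<open>L v = L\<close>, some \<open>w'\<close> satisfies \<open>w' v = e\<close>; then \<open>v w'\<close> is an idempotent as well,
  hence also a right unit, and right multiplication by \<open>w'\<close> undoes \<open>\<kappa>\<close>. Universality of \<open>M\<close> gives a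
  map \<open>j\<close> from \<open>M\<close> to \<open>L\<close>, and evaluation at a point maps \<open>L\<close> onto \<open>M\<close>; an endomorphism \<open>h\<close> of \<open>M\<close>
  sandwiched between the two is an endomorphism of \<open>L\<close>, so \<open>h\<close> is injective.\<close>

theorem universal_minimal_flow_endomorphism_inj:
  fixes M :: "'x topology"
  assumes M: "universal_minimal_flow G T M \<mu>" and T: "topspace T = carrier G"
    and h: "G_map G M \<mu> M \<mu> h"
  shows "inj_on h (topspace M)"
proof -
  define S where "S = topspace M"
  define P where "P = product_topology (\<lambda>_. M) S"
  define \<alpha> where "\<alpha> = power_action S M \<mu>"
  define m where "m = (compose S :: ('x \<Rightarrow> 'x) \<Rightarrow> ('x \<Rightarrow> 'x) \<Rightarrow> 'x \<Rightarrow> 'x)"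
  define i where "i = (\<lambda>x\<in>S. x)"
  define E where "E = P closure_of orbit G \<alpha> i"
  have minM: "minimal_flow G T M \<mu>" and M': "flow G T M \<mu>"
    using M by (auto simp: universal_minimal_flow_def minimal_flow_def)
  have HM: "Hausdorff_space M" and "compact_space M" and neM: "S \<noteq> {}"
    using M' by (auto simp: flow_def S_def)
  have P: "flow G T P \<alpha>" unfolding P_def \<alpha>_def by (rule flow_power[OF M'])
  then have HP: "Hausdorff_space P" and CP: "compact_space P" by (auto simp: flow_def)
  have topP: "p \<in> topspace P \<longleftrightarrow> p \<in> S \<rightarrow>\<^sub>E S" for p by (simp add: P_def S_def)
  have \<alpha>: "\<alpha> g p = (\<lambda>x\<in>S. \<mu> g (p x))" if "p \<in> topspace P" for g p
    using that unfolding \<alpha>_def P_def by (rule power_action_apply)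
  have i: "i \<in> topspace P" by (simp add: topP i_def)
  have m_cl: "m p q \<in> topspace P" if "p \<in> topspace P" "q \<in> topspace P" for p q
    using that by (auto simp: topP m_def compose_def)
  have m_assoc: "m (m p q) r = m p (m q r)"
    if "p \<in> topspace P" "q \<in> topspace P" "r \<in> topspace P" for p q r
    using that by (auto simp: topP m_def compose_def fun_eq_iff PiE_iff)
  have m_cont: "continuous_map P P (\<lambda>p. m p q)" if "q \<in> topspace P" for q
    unfolding P_def continuous_map_componentwise
  proof (intro conjI ballI)
    fix x assume x: "x \<in> S"
    then have "q x \<in> S" using that by (auto simp: topP)
    then show "continuous_map (product_topology (\<lambda>_. M) S) M (\<lambda>p. m p q x)"
      using x continuous_map_product_projection[of "q x" S "\<lambda>_. M"]
      by (simp add: m_def compose_def)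
  qed (auto simp: m_def compose_def)
  have m_orbit: "m (\<alpha> g i) q = \<alpha> g q" if "q \<in> topspace P" for g q
    using that i by (auto simp: \<alpha> m_def compose_def i_def topP fun_eq_iff PiE_iff)
  have m_\<alpha>: "m (\<alpha> g p) q = \<alpha> g (m p q)" if "p \<in> topspace P" "q \<in> topspace P" for g p q
    using that m_cl[OF that] by (auto simp: \<alpha> m_def compose_def topP fun_eq_iff PiE_iff)
  have EP: "E \<subseteq> topspace P" unfolding E_def by (rule closure_of_subset_topspace)
  have subE: "subflow G P \<alpha> E"
    unfolding E_def by (rule subflow_orbit_closure(1)[OF P T i])
  have ideal: "m p q \<in> W" if W: "subflow G P \<alpha> W" and p: "p \<in> E" and q: "q \<in> W" for W p q
  proof -
    have W': "closedin P W" "q \<in> topspace P"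
      using W q closedin_subset by (auto simp: subflow_def)
    show ?thesis
    proof (rule forall_in_closure_of[OF p[unfolded E_def]])
      show "m r q \<in> W" if "r \<in> orbit G \<alpha> i" for r
        using that W q m_orbit[OF W'(2)] by (auto simp: orbit_def subflow_def)
      show "closedin P {r \<in> topspace P. m r q \<in> W}"
        using m_cont[OF W'(2)] W'(1) by (rule closedin_continuous_map_preimage)
    qed
  qed
  obtain L where L: "subflow G P \<alpha> L" "L \<subseteq> E" and minL: "\<And>W. subflow G P \<alpha> W \<Longrightarrow> W \<subseteq> L \<Longrightarrow> W = L"
    using minimal_subflow_within[OF P T subE] by blast
  have LP: "L \<subseteq> topspace P" using L EP by blast
  have mL: "m p q \<in> L" if "p \<in> L" "q \<in> L" for p q
    using ideal[OF L(1)] that L(2) by blast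
  have Lq: "(\<lambda>p. m p q) ` L = L" if q: "q \<in> L" for q
  proof (rule minL)
    have "G_map G P \<alpha> P \<alpha> (\<lambda>p. m p q)"
      using q LP m_cont m_\<alpha> by (auto simp: G_map_def)
    then show "subflow G P \<alpha> ((\<lambda>p. m p q) ` L)"
      by (rule subflow_image[OF P HP _ L(1)])
  qed (use mL q in blast)
  have right_unit: "m p e = p" if e: "e \<in> L" "m e e = e" and p: "p \<in> L" for e p
  proof -
    obtain r where "r \<in> L" "p = m r e" using Lq[OF e(1)] p by blast
    then show ?thesis using e m_assoc LP by (metis subsetD)
  qed
  obtain e where e: "e \<in> L" "m e e = e"
  proof (rule compact_right_topological_semigroup_idempotent[of "subtopology P L" m])
    have top: "topspace (subtopology P L) = L" using LP by auto
    show "compact_space (subtopology P L)"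
      using L(1) CP by (auto simp: subflow_def closedin_compact_space intro: compact_space_subtopology)
    show "Hausdorff_space (subtopology P L)" using HP by (rule Hausdorff_space_subtopology)
    show "topspace (subtopology P L) \<noteq> {}" using top L(1) by (simp add: subflow_def)
    show "m p q \<in> topspace (subtopology P L)"
      if "p \<in> topspace (subtopology P L)" "q \<in> topspace (subtopology P L)" for p q
      using that mL unfolding top by blast
    show "m (m p q) r = m p (m q r)"
      if "p \<in> topspace (subtopology P L)" "q \<in> topspace (subtopology P L)"
        "r \<in> topspace (subtopology P L)" for p q r
      using that m_assoc LP unfolding top by blast
    show "continuous_map (subtopology P L) (subtopology P L) (\<lambda>p. m p q)"
      if "q \<in> topspace (subtopology P L)" for q
    proof (rule continuous_map_into_subtopology)
      show "continuous_map (subtopology P L) P (\<lambda>p. m p q)"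
        using that LP unfolding top by (intro continuous_map_from_subtopology m_cont) blast
      show "(\<lambda>p. m p q) \<in> topspace (subtopology P L) \<rightarrow> L"
        using that mL unfolding top by blast
    qed
    fix e assume "e \<in> topspace (subtopology P L)" "m e e = e"
    then show ?thesis by (intro that) (simp_all add: top)
  qed
  have "minimal_flow G T (subtopology P L) (\<lambda>g. restrict (\<alpha> g) L)"
    using minimal_flow_restrict_iff[OF P T L(1)] minL by blast
  then obtain j where "G_map G M \<mu> (subtopology P L) (\<lambda>g. restrict (\<alpha> g) L) j"
    using universal_minimal_flow_onto[OF M T] by blast
  then have j: "G_map G M \<mu> P \<alpha> j" "j ` S \<subseteq> L"
    using G_map_into_restrict unfolding S_def by blast+
  obtain x where x: "x \<in> S" using neM by blast
  have k: "G_map G P \<alpha> M \<mu> (\<lambda>p. p x)"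
    unfolding P_def \<alpha>_def using x by (rule G_map_evaluation)
  have kL: "(\<lambda>p. p x) ` L = S"
    unfolding S_def by (rule minimal_flowD[OF minM subflow_image[OF P HM k L(1)]])
  define \<kappa> where "\<kappa> = (\<lambda>p. j (h (p x)))"
  have \<kappa>: "G_map G P \<alpha> P \<alpha> \<kappa>"
    using G_map_compose[OF G_map_compose[OF k h] j(1)] by (simp add: \<kappa>_def comp_def)
  have hS: "h y \<in> S" if "y \<in> S" for y
    using h that unfolding G_map_def S_def continuous_map_def by blast
  have \<kappa>L: "\<kappa> p \<in> L" if "p \<in> topspace P" for p
    unfolding \<kappa>_def using that hS j(2) x by (auto simp: topP)
  have \<kappa>m: "\<kappa> (m p q) = m p (\<kappa> q)" if p: "p \<in> E" and q: "q \<in> topspace P" for p q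
  proof (rule forall_in_closure_of_eq[OF p[unfolded E_def] HP])
    have kq: "\<kappa> q \<in> topspace P" using \<kappa>L[OF q] LP by blast
    show "continuous_map P P (\<lambda>p. \<kappa> (m p q))"
      using continuous_map_compose[OF m_cont[OF q], of P \<kappa>] \<kappa> by (simp add: G_map_def comp_def)
    show "continuous_map P P (\<lambda>p. m p (\<kappa> q))" by (rule m_cont[OF kq])
    show "\<kappa> (m r q) = m r (\<kappa> q)" if "r \<in> orbit G \<alpha> i" for r
      using that \<kappa> q m_orbit[OF q] m_orbit[OF kq] by (auto simp: orbit_def G_map_def)
  qed
  define v where "v = \<kappa> e"
  have eP: "e \<in> topspace P" using e LP by blast
  have v: "v \<in> L" unfolding v_def by (rule \<kappa>L[OF eP])
  have ev: "m e v = v" using \<kappa>m[of e e] e L eP unfolding v_def by auto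
  obtain w where w: "w \<in> L" "m w v = e" using Lq[OF v] e(1) by (metis imageE)
  define w' where "w' = m e w"
  have w': "w' \<in> L" "m w' v = e"
    using mL e w m_assoc[of e w v] LP v by (auto simp: w'_def)
  have vw: "m v w' \<in> L" by (rule mL[OF v w'(1)])
  have assocL: "m (m p q) r = m p (m q r)" if "p \<in> L" "q \<in> L" "r \<in> L" for p q r
    using that LP by (intro m_assoc) blast+
  have "m (m v w') (m v w') = m v (m (m w' v) w')"
    by (simp only: assocL[OF v w'(1) vw] assocL[OF w'(1) v w'(1)])
  also have "m (m w' v) w' = w'"
    by (simp only: w'(2)) (simp only: w'_def assocL[OF e(1) e(1) w(1), symmetric] e(2))
  finally have vw_idem: "m (m v w') (m v w') = m v w'" .
  have unit: "m p (m v w') = p" if "p \<in> L" for p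
    by (rule right_unit[OF vw vw_idem that])
  have \<kappa>v: "\<kappa> p = m p v" if "p \<in> L" for p
    using \<kappa>m[of p e] right_unit[OF e that] that L eP unfolding v_def by auto
  have inj: "p = q" if pq: "p \<in> L" "q \<in> L" "\<kappa> p = \<kappa> q" for p q
  proof -
    have "m p (m v w') = m q (m v w')"
      using pq(3) by (simp only: assocL[OF pq(1) v w'(1), symmetric]
          assocL[OF pq(2) v w'(1), symmetric] \<kappa>v[OF pq(1), symmetric] \<kappa>v[OF pq(2), symmetric])
    then show ?thesis using unit pq by simp
  qed
  show ?thesis
  proof (rule inj_onI)
    fix a b assume ab: "a \<in> topspace M" "b \<in> topspace M" "h a = h b"
    then obtain p q where pq: "p \<in> L" "q \<in> L" "a = p x" "b = q x"
      using kL unfolding S_def by blast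
    then have "\<kappa> p = \<kappa> q" using ab by (simp add: \<kappa>_def)
    then show "a = b" using inj pq by blast
  qed
qed

text \<open>Preceded by a map from \<open>M\<close> onto \<open>N\<close>, the map \<open>p\<close> becomes an endomorphism of \<open>M\<close>.\<close>

corollary minimal_flow_onto_universal_inj:
  assumes M: "universal_minimal_flow G T M \<mu>" and T: "topspace T = carrier G"
    and N: "minimal_flow G T N \<nu>" and p: "G_map G N \<nu> M \<mu> p"
  shows "inj_on p (topspace N)"
proof -
  obtain f where f: "G_map G M \<mu> N \<nu> f" "f ` topspace M = topspace N"
    using universal_minimal_flow_onto[OF M T N] by blast
  have "inj_on (p \<circ> f) (topspace M)"
    by (rule universal_minimal_flow_endomorphism_inj[OF M T G_map_compose[OF f(1) p]])
  then show ?thesis using f(2) by (metis inj_on_imageI)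
qed

section \<open>Continuity of real functions and group operations\<close>

lemma closedin_Collect_ball:
  assumes "\<And>i. i \<in> I \<Longrightarrow> closedin X {x \<in> topspace X. P i x}"
  shows "closedin X {x \<in> topspace X. \<forall>i\<in>I. P i x}"
proof -
  have "{x \<in> topspace X. \<forall>i\<in>I. P i x} = topspace X \<inter> (\<Inter>i\<in>I. {x \<in> topspace X. P i x})"
    by auto
  also have "closedin X \<dots>"
    by (cases "I = {}") (auto intro!: closedin_Int closedin_Inter assms)
  finally show ?thesis .
qed

lemma closedin_continuous_maps_le:
  fixes f g :: "'a \<Rightarrow> real"
  assumes "continuous_map X euclideanreal f" "continuous_map X euclideanreal g"
  shows "closedin X {x \<in> topspace X. f x \<le> g x}"
proof -
  have "continuous_map X euclideanreal (\<lambda>x. f x - g x)"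
    using assms by (rule continuous_map_diff)
  then have "closedin X {x \<in> topspace X. f x - g x \<le> 0}"
    unfolding continuous_map_upper_lower_semicontinuous_le by blast
  then show ?thesis by simp
qed

lemma continuous_map_real_iff:
  fixes f :: "'a \<Rightarrow> real"
  shows "continuous_map X euclideanreal f \<longleftrightarrow>
    (\<forall>x \<in> topspace X. \<forall>\<epsilon>>0. \<exists>U. openin X U \<and> x \<in> U \<and> (\<forall>y\<in>U. \<bar>f y - f x\<bar> < \<epsilon>))"
  using Met_TC.continuous_map_to_metric[of X f]
  by (simp add: dist_real_def abs_minus_commute)

lemma topological_group_translations:
  assumes "topological_group G T" "a \<in> carrier G"
  shows "continuous_map T T (\<lambda>h. a \<otimes>\<^bsub>G\<^esub> h)" "continuous_map T T (\<lambda>h. h \<otimes>\<^bsub>G\<^esub> a)"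
proof -
  have m: "continuous_map (prod_topology T T) T (\<lambda>(g, h). g \<otimes>\<^bsub>G\<^esub> h)" and T: "topspace T = carrier G"
    using assms by (auto simp: topological_group_def)
  have "continuous_map T (prod_topology T T) (\<lambda>h. (a, h))" "continuous_map T (prod_topology T T) (\<lambda>h. (h, a))"
    using assms T by (auto simp: continuous_map_pairwise comp_def)
  from this[THEN continuous_map_compose, OF m]
  show "continuous_map T T (\<lambda>h. a \<otimes>\<^bsub>G\<^esub> h)" "continuous_map T T (\<lambda>h. h \<otimes>\<^bsub>G\<^esub> a)"
    by (simp_all add: comp_def)
qed

section \<open>Functions on a group with a given modulus\<close>

text \<open>For a bound \<open>\<rho>\<close> that tends to \<open>0\<close> at the identity, these are the functions on the group with a common
  modulus of uniform continuity for left multiplication. In the topology of pointwise convergence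
  they form a compact space, on which the group acts by right translation. A function \<open>c\<close>
  from a flow to \<open>[0,1]\<close> with \<open>\<bar>c (h x) - c x\<bar> \<le> \<rho> h\<close>, even a discontinuous one, assigns to each
  \<open>x\<close> the point \<open>\<lambda>g. c (g x)\<close> of this space; if \<open>c\<close> is continuous, this is a map of flows.\<close>

definition modulus_space :: "('g, 'm) monoid_scheme \<Rightarrow> ('g \<Rightarrow> real) \<Rightarrow> ('g \<Rightarrow> real) topology" where
  "modulus_space G \<rho> =
     subtopology (product_topology (\<lambda>_. top_of_set {0..1}) (carrier G))
       {\<psi>. \<forall>g\<in>carrier G. \<forall>h\<in>carrier G. \<bar>\<psi> (h \<otimes>\<^bsub>G\<^esub> g) - \<psi> g\<bar> \<le> \<rho> h}"

definition right_translation ::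
  "('g, 'm) monoid_scheme \<Rightarrow> ('g \<Rightarrow> real) \<Rightarrow> 'g \<Rightarrow> ('g \<Rightarrow> real) \<Rightarrow> 'g \<Rightarrow> real" where
  "right_translation G \<rho> h =
     restrict (\<lambda>\<psi>. \<lambda>g\<in>carrier G. \<psi> (g \<otimes>\<^bsub>G\<^esub> h)) (topspace (modulus_space G \<rho>))"

lemma topspace_modulus_space:
  "\<psi> \<in> topspace (modulus_space G \<rho>) \<longleftrightarrow>
     \<psi> \<in> carrier G \<rightarrow>\<^sub>E {0..1} \<and> (\<forall>g\<in>carrier G. \<forall>h\<in>carrier G. \<bar>\<psi> (h \<otimes>\<^bsub>G\<^esub> g) - \<psi> g\<bar> \<le> \<rho> h)"
  by (simp add: modulus_space_def)

lemma continuous_map_modulus_space_apply: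
  assumes "g \<in> carrier G"
  shows "continuous_map (modulus_space G \<rho>) euclideanreal (\<lambda>\<psi>. \<psi> g)"
proof -
  have "continuous_map (product_topology (\<lambda>_. top_of_set {0..1::real}) (carrier G)) euclideanreal (\<lambda>\<psi>. \<psi> g)"
    using continuous_map_product_projection[OF assms, of "\<lambda>_. top_of_set {0..1::real}"]
    by (auto intro: continuous_map_into_fulltopology)
  then show ?thesis unfolding modulus_space_def by (rule continuous_map_from_subtopology)
qed

lemma continuous_map_into_modulus_space:
  assumes "\<And>x. x \<in> topspace X \<Longrightarrow> f x \<in> topspace (modulus_space G \<rho>)"
    and "\<And>g. g \<in> carrier G \<Longrightarrow> continuous_map X euclideanreal (\<lambda>x. f x g)"
  shows "continuous_map X (modulus_space G \<rho>) f"
  unfolding modulus_space_def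
proof (rule continuous_map_into_subtopology)
  show "continuous_map X (product_topology (\<lambda>_. top_of_set {0..1}) (carrier G)) f"
    unfolding continuous_map_componentwise
    using assms by (auto simp: topspace_modulus_space continuous_map_in_subtopology PiE_iff)
qed (use assms(1) in \<open>auto simp: topspace_modulus_space\<close>)

text \<open>Joint continuity at \<open>(k, \<theta>)\<close> uses that right translation is left translation by a conjugate of
  \<open>h k\<inverse>\<close>:
  \<open>g h = (g h k\<inverse> g\<inverse>) (g k)\<close>, and the first factor tends to the identity as \<open>h\<close> tends to \<open>k\<close>, so
  the common modulus bounds \<open>\<psi> (g h) - \<psi> (g k)\<close> uniformly in \<open>\<psi>\<close>.\<close>

lemma flow_right_translation:
  assumes G: "topological_group G T"
    and nonneg: "\<And>h. h \<in> carrier G \<Longrightarrow> 0 \<le> \<rho> h"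
    and small: "\<And>\<epsilon>. 0 < \<epsilon> \<Longrightarrow> \<exists>U. openin T U \<and> \<one>\<^bsub>G\<^esub> \<in> U \<and> (\<forall>h\<in>U. \<rho> h < \<epsilon>)"
  shows "flow G T (modulus_space G \<rho>) (right_translation G \<rho>)"
  unfolding flow_def
proof (intro conjI)
  interpret group G using G by (simp add: topological_group_def)
  have T: "topspace T = carrier G" using G by (simp add: topological_group_def)
  let ?P = "product_topology (\<lambda>_. top_of_set {0..1::real}) (carrier G)"
  let ?Z = "modulus_space G \<rho>"
  have "(\<lambda>_\<in>carrier G. 0) \<in> topspace ?Z"
    using nonneg by (auto simp: topspace_modulus_space)
  then show "topspace ?Z \<noteq> {}" by blast
  have P: "Hausdorff_space ?P" "compact_space ?P"
    by (auto simp: Hausdorff_space_product_topology compact_space_product_topology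
        Hausdorff_space_subtopology compact_space_subtopology)
  then show "Hausdorff_space ?Z"
    by (simp add: modulus_space_def Hausdorff_space_subtopology)
  have proj: "continuous_map ?P euclideanreal (\<lambda>\<psi>. \<psi> g)" if "g \<in> carrier G" for g
    using continuous_map_product_projection[OF that, of "\<lambda>_. top_of_set {0..1::real}"]
    by (auto intro: continuous_map_into_fulltopology)
  have "closedin ?P {\<psi> \<in> topspace ?P. \<forall>g\<in>carrier G. \<forall>h\<in>carrier G. \<bar>\<psi> (h \<otimes>\<^bsub>G\<^esub> g) - \<psi> g\<bar> \<le> \<rho> h}"
    by (intro closedin_Collect_ball closedin_continuous_maps_le continuous_map_real_abs
        continuous_map_diff proj) auto
  moreover have "?Z = subtopology ?P
      {\<psi> \<in> topspace ?P. \<forall>g\<in>carrier G. \<forall>h\<in>carrier G. \<bar>\<psi> (h \<otimes>\<^bsub>G\<^esub> g) - \<psi> g\<bar> \<le> \<rho> h}"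
    unfolding modulus_space_def Collect_conj_eq Collect_mem_eq subtopology_restrict ..
  ultimately show "compact_space ?Z"
    using P(2) by (auto simp: closedin_compact_space intro: compact_space_subtopology)
  have trans: "(\<lambda>g\<in>carrier G. \<psi> (g \<otimes>\<^bsub>G\<^esub> h)) \<in> topspace ?Z"
    if "h \<in> carrier G" "\<psi> \<in> topspace ?Z" for h \<psi>
    using that by (auto simp: topspace_modulus_space m_assoc PiE_iff)
  show "group_action G (topspace ?Z) (right_translation G \<rho>)"
  proof (rule group_actionI)
    show "right_translation G \<rho> \<one>\<^bsub>G\<^esub> \<psi> = \<psi>" if "\<psi> \<in> topspace ?Z" for \<psi>
      using that by (auto simp: right_translation_def topspace_modulus_space fun_eq_iff PiE_iff extensional_def)
  qed (use trans in \<open>auto simp: right_translation_def m_assoc is_group\<close>)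
  show "continuous_map (prod_topology T ?Z) ?Z (\<lambda>(h, \<psi>). right_translation G \<rho> h \<psi>)"
  proof (rule continuous_map_into_modulus_space)
    show "(case p of (h, \<psi>) \<Rightarrow> right_translation G \<rho> h \<psi>) \<in> topspace ?Z"
      if "p \<in> topspace (prod_topology T ?Z)" for p
      using that trans by (auto simp: right_translation_def T)
    fix g assume g: "g \<in> carrier G"
    have "continuous_map (prod_topology T ?Z) euclideanreal (\<lambda>(h, \<psi>). \<psi> (g \<otimes>\<^bsub>G\<^esub> h))"
      unfolding continuous_map_real_iff
    proof (intro ballI allI impI)
      fix p and \<epsilon> :: real assume p: "p \<in> topspace (prod_topology T ?Z)" and \<epsilon>: "0 < \<epsilon>"
      then obtain k \<theta> where k: "p = (k, \<theta>)" "k \<in> carrier G" "\<theta> \<in> topspace ?Z"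
        by (auto simp: T)
      obtain U where U: "openin T U" "\<one>\<^bsub>G\<^esub> \<in> U" "\<And>h. h \<in> U \<Longrightarrow> \<rho> h < \<epsilon> / 2"
        using small[of "\<epsilon> / 2"] \<epsilon> by auto
      \<comment> \<open>With this choice \<open>g h a\<close> is the conjugate of \<open>h k\<inverse>\<close> by \<open>g\<close>.\<close>
      define a where "a = inv\<^bsub>G\<^esub> k \<otimes>\<^bsub>G\<^esub> inv\<^bsub>G\<^esub> g"
      have a: "a \<in> carrier G" using k g by (simp add: a_def)
      define W where "W = {h \<in> topspace T. g \<otimes>\<^bsub>G\<^esub> (h \<otimes>\<^bsub>G\<^esub> a) \<in> U}"
      have "continuous_map T T (\<lambda>h. g \<otimes>\<^bsub>G\<^esub> (h \<otimes>\<^bsub>G\<^esub> a))"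
        using continuous_map_compose[OF topological_group_translations(2)[OF G a]
            topological_group_translations(1)[OF G g]] by (simp add: comp_def)
      then have W: "openin T W"
        unfolding W_def using U(1) by (rule openin_continuous_map_preimage)
      have "g \<otimes>\<^bsub>G\<^esub> (k \<otimes>\<^bsub>G\<^esub> a) = \<one>\<^bsub>G\<^esub>"
        using k g by (simp add: a_def m_assoc[symmetric])
      then have kW: "k \<in> W" using U(2) k by (simp add: W_def T)
      define V where "V = {\<psi> \<in> topspace ?Z. \<psi> (g \<otimes>\<^bsub>G\<^esub> k) \<in> {\<theta> (g \<otimes>\<^bsub>G\<^esub> k) - \<epsilon>/2<..<\<theta> (g \<otimes>\<^bsub>G\<^esub> k) + \<epsilon>/2}}"
      have "openin ?Z V"
        unfolding V_def using k g
        by (intro openin_continuous_map_preimage[OF continuous_map_modulus_space_apply]) auto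
      moreover have "\<theta> \<in> V" using k \<epsilon> by (simp add: V_def)
      moreover have "\<bar>\<psi> (g \<otimes>\<^bsub>G\<^esub> h) - \<theta> (g \<otimes>\<^bsub>G\<^esub> k)\<bar> < \<epsilon>" if "h \<in> W" "\<psi> \<in> V" for h \<psi>
      proof -
        have h: "h \<in> carrier G" "\<rho> (g \<otimes>\<^bsub>G\<^esub> (h \<otimes>\<^bsub>G\<^esub> a)) < \<epsilon> / 2"
          using that(1) U(3) by (auto simp: W_def T)
        have "inv\<^bsub>G\<^esub> g \<otimes>\<^bsub>G\<^esub> (g \<otimes>\<^bsub>G\<^esub> k) = k"
          using k g by (simp add: m_assoc[symmetric])
        then have eq: "(g \<otimes>\<^bsub>G\<^esub> (h \<otimes>\<^bsub>G\<^esub> a)) \<otimes>\<^bsub>G\<^esub> (g \<otimes>\<^bsub>G\<^esub> k) = g \<otimes>\<^bsub>G\<^esub> h"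
          using h(1) k g by (simp add: a_def m_assoc)
        have "\<psi> \<in> topspace ?Z" using that(2) by (simp add: V_def)
        then have "\<bar>\<psi> ((g \<otimes>\<^bsub>G\<^esub> (h \<otimes>\<^bsub>G\<^esub> a)) \<otimes>\<^bsub>G\<^esub> (g \<otimes>\<^bsub>G\<^esub> k)) - \<psi> (g \<otimes>\<^bsub>G\<^esub> k)\<bar> \<le> \<rho> (g \<otimes>\<^bsub>G\<^esub> (h \<otimes>\<^bsub>G\<^esub> a))"
          using h(1) k g a by (simp add: topspace_modulus_space)
        moreover have "\<bar>\<psi> (g \<otimes>\<^bsub>G\<^esub> k) - \<theta> (g \<otimes>\<^bsub>G\<^esub> k)\<bar> < \<epsilon> / 2"
          using that(2) by (auto simp: V_def abs_if)
        ultimately show ?thesis using h(2) unfolding eq by linarith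
      qed
      ultimately show "\<exists>N. openin (prod_topology T ?Z) N \<and> p \<in> N \<and>
          (\<forall>q\<in>N. \<bar>(case q of (h, \<psi>) \<Rightarrow> \<psi> (g \<otimes>\<^bsub>G\<^esub> h)) - (case p of (h, \<psi>) \<Rightarrow> \<psi> (g \<otimes>\<^bsub>G\<^esub> h))\<bar> < \<epsilon>)"
        using W kW k(1) by (intro exI[of _ "W \<times> V"]) (auto simp: openin_prod_Times_iff)
    qed
    then show "continuous_map (prod_topology T ?Z) euclideanreal
        (\<lambda>p. (case p of (h, \<psi>) \<Rightarrow> right_translation G \<rho> h \<psi>) g)"
      by (rule continuous_map_eq) (use g in \<open>auto simp: right_translation_def\<close>)
  qed
qed

lemma G_map_orbit_function:
  assumes M: "flow G T M \<mu>" and T: "topspace T = carrier G"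
    and c: "continuous_map M (top_of_set {0..1}) c"
    and mod: "\<And>h x. h \<in> carrier G \<Longrightarrow> x \<in> topspace M \<Longrightarrow> \<bar>c (\<mu> h x) - c x\<bar> \<le> \<rho> h"
  shows "G_map G M \<mu> (modulus_space G \<rho>) (right_translation G \<rho>) (\<lambda>x. \<lambda>g\<in>carrier G. c (\<mu> g x))"
proof -
  interpret group G using M by (rule flow_group)
  have c01: "c x \<in> {0..1}" if "x \<in> topspace M" for x
    using c that by (auto simp: continuous_map_in_subtopology)
  have top: "(\<lambda>g\<in>carrier G. c (\<mu> g x)) \<in> topspace (modulus_space G \<rho>)" if "x \<in> topspace M" for x
    using that mod c01 flow_closed[OF M] flow_mult[OF M]
    by (auto simp: topspace_modulus_space simp del: atLeastAtMost_iff)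
  show ?thesis
    unfolding G_map_def
  proof (intro conjI ballI)
    show "continuous_map M (modulus_space G \<rho>) (\<lambda>x. \<lambda>g\<in>carrier G. c (\<mu> g x))"
    proof (rule continuous_map_into_modulus_space[OF top])
      fix g assume g: "g \<in> carrier G"
      have "continuous_map M euclideanreal (c \<circ> \<mu> g)"
        using flow_continuous[OF M T g] c
        by (auto intro: continuous_map_compose continuous_map_into_fulltopology)
      then show "continuous_map M euclideanreal (\<lambda>x. (\<lambda>g\<in>carrier G. c (\<mu> g x)) g)"
        using g by (simp add: comp_def)
    qed
    fix h x assume h: "h \<in> carrier G" and x: "x \<in> topspace M"
    show "(\<lambda>g\<in>carrier G. c (\<mu> g (\<mu> h x))) =
        right_translation G \<rho> h (\<lambda>g\<in>carrier G. c (\<mu> g x))"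
      using top[OF x] h x flow_mult[OF M] by (auto simp: right_translation_def fun_eq_iff)
  qed
qed

section \<open>Equicontinuity of maps from the universal minimal flow of a CAP group\<close>

lemma minimal_flow_AP:
  assumes "minimal_flow G T X \<phi>" "topspace T = carrier G" "x \<in> topspace X"
  shows "x \<in> AP G T X \<phi>"
proof -
  have X: "flow G T X \<phi>" using assms(1) by (simp add: minimal_flow_def)
  show ?thesis
    using assms(3) minimal_flowD[OF assms(1)] subflow_orbit_closure(1)[OF X assms(2,3)]
    unfolding AP_iff[OF X assms(2)] by metis
qed

text \<open>This is where CAP enters. Let \<open>d\<close> be the supremum of all admissible \<open>c\<close>. It is only lower
  semicontinuous, but it obeys the modulus \<open>\<rho>\<close>, so its orbit function \<open>\<Psi> d w = (\<lambda>g. d (g w))\<close> is a point of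
  the modulus space, and there it is a pointwise limit of the orbit functions of continuous \<open>c\<close>, the
  admissible functions being directed under \<open>max\<close>. For continuous \<open>c\<close> the pair \<open>(w, \<Psi> c w)\<close> is almost
  periodic, as the image of a point of the minimal flow \<open>M\<close>; by CAP the limit \<open>(w, \<Psi> d w)\<close> is almost
  periodic too. So its orbit closure \<open>N\<close> is minimal, and as \<open>M\<close> is universal the projection of \<open>N\<close> to \<open>M\<close> is a
  homeomorphism. Hence the function \<open>g w \<mapsto> d (g w)\<close> on the orbit of \<open>w\<close> extends to a continuous
  function \<open>e\<close> on \<open>M\<close>. It dominates every \<open>c\<close> on the dense orbit, thus everywhere, and
  \<open>e w = d w = 0\<close>.\<close>

theorem CAP_dominating_function:
  fixes M :: "'x topology" and \<rho> :: "'g \<Rightarrow> real"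
  assumes CAP: "CAP (G :: ('g, 'm) monoid_scheme) T" and M: "universal_minimal_flow G T M \<mu>"
    and w: "w \<in> topspace M"
    and nonneg: "\<And>h. h \<in> carrier G \<Longrightarrow> 0 \<le> \<rho> h"
    and small: "\<And>\<epsilon>. 0 < \<epsilon> \<Longrightarrow> \<exists>U. openin T U \<and> \<one>\<^bsub>G\<^esub> \<in> U \<and> (\<forall>h\<in>U. \<rho> h < \<epsilon>)"
  obtains e where "continuous_map M euclideanreal e" "e w = 0"
    "\<And>c x. continuous_map M (top_of_set {0..1}) c \<Longrightarrow> c w = 0 \<Longrightarrow>
       (\<And>h x. h \<in> carrier G \<Longrightarrow> x \<in> topspace M \<Longrightarrow> \<bar>c (\<mu> h x) - c x\<bar> \<le> \<rho> h) \<Longrightarrow>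
       x \<in> topspace M \<Longrightarrow> c x \<le> e x"
proof -
  have TG: "topological_group G T" and T: "topspace T = carrier G"
    using CAP by (auto simp: CAP_def topological_group_def)
  have minM: "minimal_flow G T M \<mu>" and M': "flow G T M \<mu>"
    using M by (auto simp: universal_minimal_flow_def minimal_flow_def)
  have HM: "Hausdorff_space M" using M' by (simp add: flow_def)
  interpret group G using M' by (rule flow_group)
  define S where "S = topspace M"
  define \<D> where "\<D> = {c. continuous_map M (top_of_set {0..1::real}) c \<and> c w = 0 \<and>
      (\<forall>h\<in>carrier G. \<forall>x\<in>S. \<bar>c (\<mu> h x) - c x\<bar> \<le> \<rho> h)}"
  define d where "d x = (SUP c\<in>\<D>. c x)" for x
  have zero: "(\<lambda>_. 0) \<in> \<D>" using nonneg by (auto simp: \<D>_def)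
  have D01: "0 \<le> c x" "c x \<le> 1" if "c \<in> \<D>" "x \<in> S" for c x
    using that by (auto simp: \<D>_def S_def continuous_map_in_subtopology image_subset_iff Pi_iff)
  have bdd: "bdd_above ((\<lambda>c. c x) ` \<D>)" if "x \<in> S" for x
    using D01(2) that by (intro bdd_aboveI2[where M=1])
  have d_upper: "c x \<le> d x" if "c \<in> \<D>" "x \<in> S" for c x
    unfolding d_def using that bdd by (intro cSUP_upper)
  have d_least: "d x \<le> b" if "\<And>c. c \<in> \<D> \<Longrightarrow> c x \<le> b" for x b
    unfolding d_def using that zero by (intro cSUP_least) auto
  have d01: "d x \<in> {0..1}" if "x \<in> S" for x
    using d_upper[OF zero that] d_least D01(2) that by auto
  have S_inv: "\<mu> h x \<in> S" if "h \<in> carrier G" "x \<in> S" for h x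
    using that flow_closed[OF M'] by (simp add: S_def)
  have d_mod: "\<bar>d (\<mu> h x) - d x\<bar> \<le> \<rho> h" if h: "h \<in> carrier G" and x: "x \<in> S" for h x
  proof -
    have c: "\<bar>c (\<mu> h x) - c x\<bar> \<le> \<rho> h" if "c \<in> \<D>" for c
      using that h x by (simp add: \<D>_def)
    have "d (\<mu> h x) \<le> d x + \<rho> h"
    proof (rule d_least)
      fix c assume "c \<in> \<D>"
      then show "c (\<mu> h x) \<le> d x + \<rho> h" using c[of c] d_upper[of c x] x by linarith
    qed
    moreover have "d x \<le> d (\<mu> h x) + \<rho> h"
    proof (rule d_least)
      fix c assume "c \<in> \<D>"
      then show "c x \<le> d (\<mu> h x) + \<rho> h" using c[of c] d_upper[of c "\<mu> h x"] S_inv[OF h x] by linarith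
    qed
    ultimately show ?thesis by linarith
  qed
  have max: "(\<lambda>x. max (b x) (c x)) \<in> \<D>" if "b \<in> \<D>" "c \<in> \<D>" for b c
  proof -
    have "continuous_map M euclideanreal (\<lambda>x. max (b x) (c x))"
      using that by (intro continuous_map_real_max) (auto simp: \<D>_def continuous_map_in_subtopology)
    moreover have "max (b x) (c x) \<in> {0..1}" if "x \<in> S" for x
      using D01 that \<open>b \<in> \<D>\<close> \<open>c \<in> \<D>\<close> by (auto simp: max_def)
    moreover have "\<bar>max (b (\<mu> h x)) (c (\<mu> h x)) - max (b x) (c x)\<bar> \<le> \<rho> h"
      if "h \<in> carrier G" "x \<in> S" for h x
    proof -
      have "\<bar>b (\<mu> h x) - b x\<bar> \<le> \<rho> h" "\<bar>c (\<mu> h x) - c x\<bar> \<le> \<rho> h"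
        using that \<open>b \<in> \<D>\<close> \<open>c \<in> \<D>\<close> by (auto simp: \<D>_def)
      then show ?thesis by (auto simp: max_def)
    qed
    ultimately show ?thesis
      using that by (auto simp: \<D>_def S_def continuous_map_in_subtopology)
  qed
  \<comment> \<open>The functions \<open>k F\<close>, indexed by finite sets \<open>F\<close> of admissible functions, form a net converging to \<open>d\<close>.\<close>
  have "\<exists>k\<in>\<D>. \<forall>c\<in>F. \<forall>x. c x \<le> k x" if "finite F" "F \<subseteq> \<D>" for F
    using that
  proof (induction F)
    case empty then show ?case using zero by blast
  next
    case (insert b F)
    then obtain k where k: "k \<in> \<D>" "\<forall>c\<in>F. \<forall>x. c x \<le> k x" by auto
    then show ?case
      using insert.prems max[of b k] by (intro bexI[of _ "\<lambda>x. max (b x) (k x)"]) (auto simp: le_max_iff_disj)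
  qed
  then obtain k where k: "\<And>F. finite F \<Longrightarrow> F \<subseteq> \<D> \<Longrightarrow> k F \<in> \<D>"
    and kF: "\<And>F c x. finite F \<Longrightarrow> F \<subseteq> \<D> \<Longrightarrow> c \<in> F \<Longrightarrow> c x \<le> k F x"
    by metis
  let ?\<F> = "finite_subsets_at_top \<D>"
  have ev: "\<forall>\<^sub>F F in ?\<F>. finite F \<and> F \<subseteq> \<D>"
    by (rule eventually_finite_subsets_at_top_weakI) auto
  have lim_d: "((\<lambda>F. k F x) \<longlongrightarrow> d x) ?\<F>" if x: "x \<in> S" for x
  proof (rule tendstoI)
    fix \<epsilon> :: real assume "0 < \<epsilon>"
    then obtain c where c: "c \<in> \<D>" "d x - \<epsilon> < c x"
      using d_least[of x "d x - \<epsilon>"] by (meson diff_less_eq less_add_same_cancel1 not_le)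
    have "\<forall>\<^sub>F F in ?\<F>. finite F \<and> {c} \<subseteq> F \<and> F \<subseteq> \<D>"
      unfolding eventually_finite_subsets_at_top using c(1) by (intro exI[of _ "{c}"]) simp
    then show "\<forall>\<^sub>F F in ?\<F>. dist (k F x) (d x) < \<epsilon>"
    proof eventually_elim
      case (elim F)
      then have "c x \<le> k F x" "k F x \<le> d x" using kF k d_upper[OF _ x] by auto
      then show ?case using c(2) by (simp add: dist_real_def)
    qed
  qed
  define Z where "Z = modulus_space G \<rho>"
  define \<tau> where "\<tau> = right_translation G \<rho>"
  have Z: "flow G T Z \<tau>"
    unfolding Z_def \<tau>_def by (rule flow_right_translation[OF TG nonneg small])
  define \<Psi> where "\<Psi> c x = (\<lambda>g\<in>carrier G. c (\<mu> g x))" for c :: "'x \<Rightarrow> real" and x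
  have \<Psi>: "G_map G M \<mu> Z \<tau> (\<Psi> c)" if "c \<in> \<D>" for c
    unfolding Z_def \<tau>_def \<Psi>_def using that
    by (intro G_map_orbit_function[OF M' T]) (auto simp: \<D>_def S_def)
  have \<Psi>Z: "\<Psi> c x \<in> topspace Z" if "c \<in> \<D>" "x \<in> S" for c x
    using \<Psi>[OF that(1)] that(2) continuous_map_image_subset_topspace
    unfolding G_map_def S_def by fast
  have \<Psi>d: "\<Psi> d x \<in> topspace Z" if "x \<in> S" for x
    using that d01 d_mod S_inv flow_mult[OF M']
    by (auto simp: Z_def \<Psi>_def topspace_modulus_space S_def[symmetric] simp del: atLeastAtMost_iff)
  define V where "V = prod_topology M Z"
  define \<delta> where "\<delta> g = prod_action M \<mu> Z \<tau> (g, g)" for g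
  have \<delta>: "\<delta> g (x, \<psi>) = (\<mu> g x, \<tau> g \<psi>)" if "x \<in> S" "\<psi> \<in> topspace Z" for g x \<psi>
    using that by (simp add: \<delta>_def prod_action_def S_def)
  have V: "flow G T V \<delta>"
    unfolding V_def \<delta>_def
  proof (rule flow_pullback[OF flow_prod[OF M' Z]])
    show "(\<lambda>g. (g, g)) \<in> hom G (G \<times>\<times> G)" by (auto simp: hom_def)
    show "continuous_map T (prod_topology T T) (\<lambda>g. (g, g))"
      by (intro continuous_map_pairedI continuous_map_id[unfolded id_def])
  qed (rule is_group)
  have HV: "Hausdorff_space V" using V by (simp add: flow_def)
  have AP: "(w, \<Psi> c w) \<in> AP G T V \<delta>" if c: "c \<in> \<D>" for c
  proof (rule AP_image[OF M' T V])
    show "w \<in> AP G T M \<mu>" by (rule minimal_flow_AP[OF minM T w])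
    have "continuous_map M M (\<lambda>x. x)" by (rule continuous_map_id[unfolded id_def])
    then show "G_map G M \<mu> V \<delta> (\<lambda>x. (x, \<Psi> c x))"
      using \<Psi>[OF c] \<Psi>Z[OF c] by (simp add: G_map_def V_def continuous_map_pairedI \<delta> S_def)
  qed
  define p where "p = (w, \<Psi> d w)"
  have wS: "w \<in> S" using w by (simp add: S_def)
  have "limitin V (\<lambda>F. (w, \<Psi> (k F) w)) p ?\<F>"
    unfolding V_def limitin_pairwise p_def
  proof
    show "limitin M (fst \<circ> (\<lambda>F. (w, \<Psi> (k F) w))) (fst (w, \<Psi> d w)) ?\<F>"
      using w by (simp add: comp_def)
    have conv: "limitin (product_topology (\<lambda>_. top_of_set {0..1}) (carrier G))
        (\<lambda>F. \<Psi> (k F) w) (\<Psi> d w) ?\<F>"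
      unfolding limitin_componentwise
    proof (intro conjI ballI)
      show "\<Psi> d w \<in> extensional (carrier G)" by (simp add: \<Psi>_def)
      show "\<forall>\<^sub>F F in ?\<F>. \<Psi> (k F) w \<in> topspace (product_topology (\<lambda>_. top_of_set {0..1}) (carrier G))"
        using ev
      proof eventually_elim
        case (elim F)
        then show ?case using \<Psi>Z[OF k wS] by (auto simp: Z_def topspace_modulus_space)
      qed
      fix g assume g: "g \<in> carrier G"
      then have gw: "\<mu> g w \<in> S" using S_inv wS by blast
      have "\<forall>\<^sub>F F in ?\<F>. k F (\<mu> g w) \<in> {0..1}"
        using ev
      proof eventually_elim
        case (elim F)
        then show ?case using D01[OF k gw] by auto
      qed
      then show "limitin (top_of_set {0..1}) (\<lambda>F. \<Psi> (k F) w g) (\<Psi> d w g) ?\<F>"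
        using g lim_d[OF gw] d01[OF gw] by (simp add: \<Psi>_def limitin_subtopology)
    qed
    have "\<forall>\<^sub>F F in ?\<F>. \<Psi> (k F) w \<in> topspace Z"
      using ev by eventually_elim (use \<Psi>Z k wS in blast)
    then show "limitin Z (snd \<circ> (\<lambda>F. (w, \<Psi> (k F) w))) (snd (w, \<Psi> d w)) ?\<F>"
      using conv \<Psi>d[OF wS] unfolding Z_def modulus_space_def limitin_subtopology
      by (auto simp: comp_def elim: eventually_mono)
  qed
  moreover have "\<forall>\<^sub>F F in ?\<F>. (w, \<Psi> (k F) w) \<in> AP G T V \<delta>"
    using ev by eventually_elim (use AP k in blast)
  ultimately have pAP: "p \<in> AP G T V \<delta>"
    using CAP_closedin_AP[OF CAP V] by (intro limitin_closedin) auto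
  then have pV: "p \<in> topspace V" by (simp add: AP_def)
  define N where "N = V closure_of orbit G \<delta> p"
  have N: "subflow G V \<delta> N" "p \<in> N"
    unfolding N_def using subflow_orbit_closure[OF V T pV] by auto
  have topN: "topspace (subtopology V N) = N"
    using N(1) closedin_subset by (fastforce simp: subflow_def)
  have minN: "minimal_flow G T (subtopology V N) (\<lambda>g. restrict (\<delta> g) N)"
    using pAP by (simp add: AP_def Let_def N_def)
  have "G_map G V \<delta> M \<mu> fst"
    by (auto simp: G_map_def V_def continuous_map_fst \<delta> S_def)
  then have fst: "G_map G (subtopology V N) (\<lambda>g. restrict (\<delta> g) N) M \<mu> fst"
    by (rule G_map_from_restrict)
  have inj: "inj_on fst N"
    using minimal_flow_onto_universal_inj[OF M T minN fst] topN by simp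
  have flowN: "flow G T (subtopology V N) (\<lambda>g. restrict (\<delta> g) N)"
    using minN by (simp add: minimal_flow_def)
  have "fst ` N = S"
    using minimal_map_surj[OF flowN minM fst] topN S_def by simp
  then have "homeomorphic_map (subtopology V N) M fst"
    using fst HM flowN inj topN
    by (intro continuous_imp_homeomorphic_map) (auto simp: G_map_def flow_def S_def)
  then obtain s where s: "homeomorphic_maps (subtopology V N) M fst s"
    using homeomorphic_map_maps by blast
  have sN: "s x \<in> N" "fst (s x) = x" if "x \<in> S" for x
    using s that continuous_map_image_subset_topspace topN
    by (fastforce simp: homeomorphic_maps_def S_def)+
  have sV: "continuous_map M V s"
    using s by (auto simp: homeomorphic_maps_def continuous_map_in_subtopology)
  have one_cont: "continuous_map V euclideanreal (\<lambda>q. snd q \<one>\<^bsub>G\<^esub>)"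
    using continuous_map_compose[OF continuous_map_snd continuous_map_modulus_space_apply[OF one_closed, of \<rho>]]
    by (simp add: V_def Z_def comp_def)
  define e where "e x = snd (s x) \<one>\<^bsub>G\<^esub>" for x
  show ?thesis
  proof (rule that)
    show "continuous_map M euclideanreal e"
      using continuous_map_compose[OF sV one_cont] by (simp add: e_def[abs_def] comp_def)
    have "s w = p" using inj sN[OF wS] N(2) by (metis fst_conv inj_onD p_def)
    then have "e w = d w" using flow_one[OF M' w] by (simp add: e_def p_def \<Psi>_def)
    also have "d w = 0"
      using d_upper[OF zero wS] d_least[of w 0] by (force simp: \<D>_def)
    finally show "e w = 0" .
    fix c x assume c: "continuous_map M (top_of_set {0..1}) c" "c w = 0"
      "\<And>h x. h \<in> carrier G \<Longrightarrow> x \<in> topspace M \<Longrightarrow> \<bar>c (\<mu> h x) - c x\<bar> \<le> \<rho> h" and "x \<in> topspace M"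
    then have x: "x \<in> S" and cD: "c \<in> \<D>" by (auto simp: \<D>_def S_def)
    have "c (fst q) \<le> snd q \<one>\<^bsub>G\<^esub>" if q: "q \<in> N" for q
    proof (rule forall_in_closure_of[OF q[unfolded N_def]])
      fix q assume "q \<in> orbit G \<delta> p"
      then obtain g where g: "g \<in> carrier G" "q = \<delta> g p" by (auto simp: orbit_def)
      then have "q = (\<mu> g w, \<tau> g (\<Psi> d w))" using \<delta>[OF wS \<Psi>d[OF wS]] by (simp add: p_def)
      moreover have "\<tau> g (\<Psi> d w) \<one>\<^bsub>G\<^esub> = d (\<mu> g w)"
        using \<Psi>d[OF wS] g by (simp add: \<tau>_def right_translation_def Z_def \<Psi>_def)
      ultimately show "c (fst q) \<le> snd q \<one>\<^bsub>G\<^esub>"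
        using d_upper[OF cD S_inv[OF g(1) wS]] by simp
    next
      have "continuous_map V M fst" unfolding V_def by (rule continuous_map_fst)
      then have "continuous_map V euclideanreal (c \<circ> fst)"
        using c(1) by (rule continuous_map_compose[OF _ continuous_map_into_fulltopology])
      then show "closedin V {q \<in> topspace V. c (fst q) \<le> snd q \<one>\<^bsub>G\<^esub>}"
        using one_cont by (intro closedin_continuous_maps_le) (simp_all add: comp_def)
    qed
    from this[of "s x"] show "c x \<le> e x" using sN[OF x] by (simp add: e_def)
  qed
qed

text \<open>Projection along the compact space \<open>X\<close> is closed, so the group elements that move some value of
  \<open>u\<close> by at least \<open>\<epsilon>\<close> form a closed set.\<close>

lemma flow_uniformly_small_displacement:
  assumes X: "flow G T X \<phi>" and T: "topspace T = carrier G"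
    and u: "continuous_map X euclideanreal u" and "0 < \<epsilon>"
  obtains U where "openin T U" "\<one>\<^bsub>G\<^esub> \<in> U"
    "\<And>h x. h \<in> U \<Longrightarrow> x \<in> topspace X \<Longrightarrow> \<bar>u (\<phi> h x) - u x\<bar> < \<epsilon>"
proof -
  interpret group G using X by (rule flow_group)
  let ?P = "prod_topology T X"
  let ?f = "\<lambda>p. \<bar>u (\<phi> (fst p) (snd p)) - u (snd p)\<bar>"
  define C where "C = {p \<in> topspace ?P. \<epsilon> \<le> ?f p}"
  have "continuous_map ?P X (\<lambda>p. \<phi> (fst p) (snd p))"
    using X by (simp add: flow_def case_prod_unfold)
  then have "continuous_map ?P euclideanreal ?f"
    using continuous_map_compose[OF _ u] continuous_map_snd[of T X]
    by (intro continuous_map_real_abs continuous_map_diff) (force simp: comp_def)+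
  then have "closedin ?P C"
    unfolding C_def by (intro closedin_continuous_maps_le) auto
  then have "closedin T (fst ` C)"
    using X closed_map_fst[of X T] by (auto simp: flow_def closed_map_def)
  then have "openin T (topspace T - fst ` C)" by blast
  moreover have "\<one>\<^bsub>G\<^esub> \<in> topspace T - fst ` C"
    using flow_one[OF X] \<open>0 < \<epsilon>\<close> by (auto simp: C_def T)
  moreover have "\<bar>u (\<phi> h x) - u x\<bar> < \<epsilon>" if "h \<in> topspace T - fst ` C" "x \<in> topspace X" for h x
  proof (rule ccontr)
    assume "\<not> ?thesis"
    then have "(h, x) \<in> C" using that by (simp add: C_def)
    then show False using that(1) by force
  qed
  ultimately show ?thesis by (rule that)
qed

text \<open>Equicontinuity at \<open>w\<close> of all maps from \<open>M\<close> to \<open>X\<close>. By equivariance, the function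
  \<open>\<lambda>y. \<bar>u (f y) - u (f w)\<bar>\<close> on \<open>M\<close> has a modulus that does not depend on \<open>f\<close>: a group element \<open>h\<close> changes it
  by at most the largest displacement \<open>\<rho> h\<close> of \<open>u\<close> on \<open>X\<close>. One function \<open>e\<close> dominates all of them.\<close>

theorem CAP_equicontinuous_maps:
  assumes CAP: "CAP G T" and M: "universal_minimal_flow G T M \<mu>"
    and X: "flow G T X \<phi>" and u: "continuous_map X (top_of_set {0..1}) u" and w: "w \<in> topspace M"
  obtains e where "continuous_map M euclideanreal e" "e w = 0"
    "\<And>f x. G_map G M \<mu> X \<phi> f \<Longrightarrow> x \<in> topspace M \<Longrightarrow> \<bar>u (f x) - u (f w)\<bar> \<le> e x"
proof -
  have T: "topspace T = carrier G"
    using CAP by (simp add: CAP_def topological_group_def)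
  have M': "flow G T M \<mu>" using M by (simp add: universal_minimal_flow_def minimal_flow_def)
  have ureal: "continuous_map X euclideanreal u" and u01: "\<And>x. x \<in> topspace X \<Longrightarrow> u x \<in> {0..1}"
    using u by (auto simp: continuous_map_in_subtopology simp del: atLeastAtMost_iff)
  have neX: "topspace X \<noteq> {}" using X by (simp add: flow_def)
  define \<rho> where "\<rho> h = (SUP x\<in>topspace X. \<bar>u (\<phi> h x) - u x\<bar>)" for h
  have le\<rho>: "\<bar>u (\<phi> h x) - u x\<bar> \<le> \<rho> h" if h: "h \<in> carrier G" and "x \<in> topspace X" for h x
    unfolding \<rho>_def
  proof (rule cSUP_upper)
    have "\<bar>u (\<phi> h y) - u y\<bar> \<le> 1" if "y \<in> topspace X" for y
      using u01[OF that] u01[OF flow_closed[OF X h that]] by auto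
    then show "bdd_above ((\<lambda>x. \<bar>u (\<phi> h x) - u x\<bar>) ` topspace X)"
      by (rule bdd_aboveI2)
  qed fact
  have nonneg: "0 \<le> \<rho> h" if "h \<in> carrier G" for h
  proof -
    obtain x where "x \<in> topspace X" using neX by blast
    then show ?thesis using le\<rho>[OF that, of x] by linarith
  qed
  have small: "\<exists>U. openin T U \<and> \<one>\<^bsub>G\<^esub> \<in> U \<and> (\<forall>h\<in>U. \<rho> h < \<epsilon>)" if "0 < \<epsilon>" for \<epsilon>
  proof -
    have "0 < \<epsilon> / 2" using that by simp
    then obtain U where U: "openin T U" "\<one>\<^bsub>G\<^esub> \<in> U"
      "\<And>h x. h \<in> U \<Longrightarrow> x \<in> topspace X \<Longrightarrow> \<bar>u (\<phi> h x) - u x\<bar> < \<epsilon> / 2"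
      using flow_uniformly_small_displacement[OF X T ureal] by blast
    have "\<rho> h < \<epsilon>" if "h \<in> U" for h
    proof -
      have "\<rho> h \<le> \<epsilon> / 2"
        unfolding \<rho>_def using neX U(3)[OF that] by (intro cSUP_least less_imp_le) auto
      then show ?thesis using \<open>0 < \<epsilon>\<close> by linarith
    qed
    then show ?thesis using U by blast
  qed
  obtain e where e: "continuous_map M euclideanreal e" "e w = 0"
    and dom: "\<And>c x. continuous_map M (top_of_set {0..1}) c \<Longrightarrow> c w = 0 \<Longrightarrow>
       (\<And>h x. h \<in> carrier G \<Longrightarrow> x \<in> topspace M \<Longrightarrow> \<bar>c (\<mu> h x) - c x\<bar> \<le> \<rho> h) \<Longrightarrow>
       x \<in> topspace M \<Longrightarrow> c x \<le> e x"
    using CAP_dominating_function[OF CAP M w nonneg small] by blast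
  show ?thesis
  proof (rule that[OF e])
    fix f x assume f: "G_map G M \<mu> X \<phi> f" and x: "x \<in> topspace M"
    have fX: "f y \<in> topspace X" if "y \<in> topspace M" for y
      using f that continuous_map_image_subset_topspace unfolding G_map_def by fast
    have eqv: "f (\<mu> h y) = \<phi> h (f y)" if "h \<in> carrier G" "y \<in> topspace M" for h y
      using f that by (simp add: G_map_def)
    show "\<bar>u (f x) - u (f w)\<bar> \<le> e x"
    proof (rule dom[of "\<lambda>y. \<bar>u (f y) - u (f w)\<bar>"])
      have "continuous_map M euclideanreal (u \<circ> f)"
        using f ureal by (auto simp: G_map_def intro: continuous_map_compose)
      then have "continuous_map M euclideanreal (\<lambda>y. \<bar>u (f y) - u (f w)\<bar>)"
        by (intro continuous_map_real_abs continuous_map_diff) (auto simp: comp_def)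
      moreover have "\<bar>u (f y) - u (f w)\<bar> \<in> {0..1}" if "y \<in> topspace M" for y
        using u01[OF fX[OF that]] u01[OF fX[OF w]] by auto
      ultimately show "continuous_map M (top_of_set {0..1}) (\<lambda>y. \<bar>u (f y) - u (f w)\<bar>)"
        by (auto simp: continuous_map_in_subtopology)
      show "\<bar>\<bar>u (f (\<mu> h y)) - u (f w)\<bar> - \<bar>u (f y) - u (f w)\<bar>\<bar> \<le> \<rho> h"
        if "h \<in> carrier G" "y \<in> topspace M" for h y
        using le\<rho>[OF that(1) fX[OF that(2)]] unfolding eqv[OF that] by linarith
    qed (use x in auto)
  qed
qed

section \<open>The compact space of maps of flows\<close>

text \<open>The compact Hausdorff space \<open>X\<close> carries the topology induced by its continuous functions to
  \<open>[0,1]\<close>, so it is enough to control \<open>u (g x)\<close>, where \<open>g w\<close> is close to \<open>f w\<close> and \<open>x\<close> is close to \<open>w\<close>.\<close>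

lemma continuous_map_evaluation_equicontinuous:
  fixes M :: "'a topology" and X :: "'b topology"
  defines "P \<equiv> product_topology (\<lambda>_. X) (topspace M)"
  assumes X: "compact_space X" "Hausdorff_space X" and F: "\<F> \<subseteq> topspace P"
    and equi: "\<And>u w. continuous_map X (top_of_set {0..1::real}) u \<Longrightarrow> w \<in> topspace M \<Longrightarrow>
      \<exists>e. continuous_map M euclideanreal e \<and> e w = 0 \<and>
        (\<forall>f\<in>\<F>. \<forall>x\<in>topspace M. \<bar>u (f x) - u (f w)\<bar> \<le> e x)"
  shows "continuous_map (prod_topology (subtopology P \<F>) M) X (\<lambda>(f, x). f x)"
  unfolding continuous_map_eq_topcontinuous_at
proof
  let ?Q = "prod_topology (subtopology P \<F>) M"
  fix p assume p: "p \<in> topspace ?Q"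
  then obtain f w where f: "p = (f, w)" "f \<in> \<F>" "w \<in> topspace M" by auto
  then have fw: "f w \<in> topspace X" using F by (auto simp: P_def)
  have "\<exists>U. openin ?Q U \<and> p \<in> U \<and> (\<forall>(g, x)\<in>U. g x \<in> W)" if W: "openin X W" "f w \<in> W" for W
  proof -
    have "normal_space X" using X by (simp add: compact_Hausdorff_or_regular_imp_normal_space)
    then obtain u :: "'b \<Rightarrow> real" where u: "continuous_map X (top_of_set {0..1}) u"
      "u ` {f w} \<subseteq> {0}" "u ` (topspace X - W) \<subseteq> {1}"
      using X W fw
      by (elim Urysohn_lemma[of X "{f w}" "topspace X - W" 0 1])
        (auto simp: closedin_Hausdorff_singleton disjnt_iff)
    obtain e where e: "continuous_map M euclideanreal e" "e w = 0"
      "\<And>g x. g \<in> \<F> \<Longrightarrow> x \<in> topspace M \<Longrightarrow> \<bar>u (g x) - u (g w)\<bar> \<le> e x"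
      using equi[OF u(1) f(3)] by blast
    define A where "A = {g \<in> topspace (subtopology P \<F>). (u \<circ> (\<lambda>g. g w)) g \<in> {..<1/2}}"
    define B where "B = {x \<in> topspace M. e x \<in> {..<1/2}}"
    have "continuous_map P X (\<lambda>g. g w)"
      unfolding P_def using f(3) by (rule continuous_map_product_projection)
    then have "continuous_map (subtopology P \<F>) euclideanreal (u \<circ> (\<lambda>g. g w))"
      using u(1) by (intro continuous_map_from_subtopology continuous_map_compose)
        (auto intro: continuous_map_into_fulltopology)
    then have "openin (subtopology P \<F>) A"
      unfolding A_def by (rule openin_continuous_map_preimage) auto
    moreover have "openin M B"
      unfolding B_def using e(1) by (rule openin_continuous_map_preimage) auto
    moreover have "f \<in> A" "w \<in> B"
      using f F u(2) e(2) by (auto simp: A_def B_def)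
    moreover have "g x \<in> W" if "g \<in> A" "x \<in> B" for g x
    proof (rule ccontr)
      have "g \<in> \<F>" "x \<in> topspace M" "u (g w) < 1/2" "e x < 1/2"
        using that by (auto simp: A_def B_def)
      moreover from this have "g x \<in> topspace X" using F by (auto simp: P_def)
      moreover assume "g x \<notin> W"
      ultimately have "u (g x) = 1" using u(3) by blast
      then show False using e(3)[of g x] \<open>g \<in> \<F>\<close> \<open>x \<in> topspace M\<close> \<open>u (g w) < 1/2\<close> \<open>e x < 1/2\<close>
        by linarith
    qed
    ultimately show ?thesis
      using f(1) by (intro exI[of _ "A \<times> B"]) (auto simp: openin_prod_Times_iff)
  qed
  then show "topcontinuous_at ?Q X (\<lambda>(f, x). f x) p"
    unfolding topcontinuous_at_def using p f fw subsetD[OF F] by (auto simp: case_prod_unfold P_def)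
qed

text \<open>A pointwise limit of maps of flows inherits the bounds of equicontinuity, hence is continuous.
  So for CAP groups the pointwise topology makes the set of all maps \<open>M \<rightarrow> X\<close> a compact space on which
  evaluation is jointly continuous.\<close>

theorem CAP_closedin_G_maps:
  fixes M :: "'a topology" and X :: "'b topology"
  defines "P \<equiv> product_topology (\<lambda>_. X) (topspace M)"
  assumes CAP: "CAP G T" and M: "universal_minimal_flow G T M \<mu>" and X: "flow G T X \<phi>"
  shows "closedin P {f \<in> topspace P. G_map G M \<mu> X \<phi> f}"
    and "continuous_map (prod_topology (subtopology P {f \<in> topspace P. G_map G M \<mu> X \<phi> f}) M) X
           (\<lambda>(f, x). f x)"
proof -
  let ?F = "{f \<in> topspace P. G_map G M \<mu> X \<phi> f}"
  let ?C = "P closure_of ?F"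
  have T: "topspace T = carrier G"
    using CAP by (simp add: CAP_def topological_group_def)
  have M': "flow G T M \<mu>" using M by (simp add: universal_minimal_flow_def minimal_flow_def)
  have HX: "Hausdorff_space X" "compact_space X" using X by (auto simp: flow_def)
  have proj: "continuous_map P X (\<lambda>f. f x)" if "x \<in> topspace M" for x
    unfolding P_def using that by (rule continuous_map_product_projection)
  have CP: "?C \<subseteq> topspace P" by (rule closure_of_subset_topspace)
  have cont: "continuous_map (prod_topology (subtopology P ?C) M) X (\<lambda>(f, x). f x)"
    unfolding P_def
  proof (rule continuous_map_evaluation_equicontinuous[OF HX(2,1)])
    show "product_topology (\<lambda>_. X) (topspace M) closure_of
        {f \<in> topspace (product_topology (\<lambda>_. X) (topspace M)). G_map G M \<mu> X \<phi> f}
        \<subseteq> topspace (product_topology (\<lambda>_. X) (topspace M))" by (rule closure_of_subset_topspace)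
    fix u :: "'b \<Rightarrow> real" and w assume u: "continuous_map X (top_of_set {0..1}) u" and w: "w \<in> topspace M"
    have ureal: "continuous_map X euclideanreal u" using u by (rule continuous_map_into_fulltopology)
    obtain e where e: "continuous_map M euclideanreal e" "e w = 0"
      "\<And>f x. G_map G M \<mu> X \<phi> f \<Longrightarrow> x \<in> topspace M \<Longrightarrow> \<bar>u (f x) - u (f w)\<bar> \<le> e x"
      using CAP_equicontinuous_maps[OF CAP M X u w] by blast
    have "\<bar>u (f x) - u (f w)\<bar> \<le> e x" if f: "f \<in> ?C" and x: "x \<in> topspace M" for f x
    proof (rule forall_in_closure_of[OF f])
      show "\<bar>u (f x) - u (f w)\<bar> \<le> e x" if "f \<in> ?F" for f using that e(3) x by blast
      have "continuous_map P euclideanreal (\<lambda>f. u (f y))" if "y \<in> topspace M" for y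
        using continuous_map_compose[OF proj[OF that] ureal] by (simp add: comp_def)
      then show "closedin P {f \<in> topspace P. \<bar>u (f x) - u (f w)\<bar> \<le> e x}"
        using x w by (intro closedin_continuous_maps_le continuous_map_real_abs continuous_map_diff) auto
    qed
    then show "\<exists>e. continuous_map M euclideanreal e \<and> e w = 0 \<and>
        (\<forall>f\<in>product_topology (\<lambda>_. X) (topspace M) closure_of
          {f \<in> topspace (product_topology (\<lambda>_. X) (topspace M)). G_map G M \<mu> X \<phi> f}.
          \<forall>x\<in>topspace M. \<bar>u (f x) - u (f w)\<bar> \<le> e x)"
      using e unfolding P_def by blast
  qed
  have "?C \<subseteq> ?F"
  proof
    fix f assume f: "f \<in> ?C"
    have "continuous_map M (prod_topology (subtopology P ?C) M) (\<lambda>x. (f, x))"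
      using f CP continuous_map_id[of M] by (intro continuous_map_pairedI) (auto simp: id_def)
    from continuous_map_compose[OF this cont]
    have "continuous_map M X f" by (simp add: comp_def)
    moreover have "f (\<mu> g x) = \<phi> g (f x)" if g: "g \<in> carrier G" and x: "x \<in> topspace M" for g x
    proof (rule forall_in_closure_of_eq[OF f HX(1)])
      show "continuous_map P X (\<lambda>f. f (\<mu> g x))" by (rule proj[OF flow_closed[OF M' g x]])
      show "continuous_map P X (\<lambda>f. \<phi> g (f x))"
        using continuous_map_compose[OF proj[OF x] flow_continuous[OF X T g]] by (simp add: comp_def)
    qed (use g x in \<open>auto simp: G_map_def\<close>)
    ultimately show "f \<in> ?F" using f CP by (auto simp: G_map_def)
  qed
  then show closed: "closedin P ?F"
    by (metis (no_types, lifting) closure_of_subset_eq mem_Collect_eq subsetI)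
  then show "continuous_map (prod_topology (subtopology P ?F) M) X (\<lambda>(f, x). f x)"
    using cont by (simp add: closure_of_closedin)
qed

section \<open>Commuting actions\<close>

text \<open>The compact space \<open>\<F>\<close> of \<open>H\<close>-maps \<open>M \<rightarrow> X\<close> is a \<open>K\<close>-flow; let \<open>\<E>\<close> be a minimal subflow of it. The values
  \<open>f x\<close> with \<open>f \<in> \<E>\<close> and \<open>x \<in> M\<close> form a closed set that is invariant under \<open>H\<close> and \<open>K\<close>, hence fill \<open>X\<close>. As \<open>\<pi>\<close> is
  \<open>K\<close>-invariant and \<open>\<E>\<close> is a \<open>K\<close>-orbit closure, the endomorphism \<open>\<pi> \<circ> f\<close> of \<open>M\<close> is the same for all
  \<open>f \<in> \<E>\<close>, and it is injective. So if \<open>q = f x\<close> and \<open>q' = f' x'\<close> lie in one fibre of \<open>\<pi>\<close>, then \<open>x = x'\<close>, and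
  \<open>q' = f' x\<close> lies in the \<open>K\<close>-orbit closure of \<open>f x = q\<close> since \<open>f'\<close> lies in that of \<open>f\<close>.\<close>

theorem CAP_fibre_in_orbit_closure:
  assumes CAP: "CAP H T" and M: "universal_minimal_flow H T M \<mu>"
    and X: "flow H T X \<phi>" and K: "flow K T' X \<kappa>" and T': "topspace T' = carrier K"
    and comm: "\<And>h k x. h \<in> carrier H \<Longrightarrow> k \<in> carrier K \<Longrightarrow> x \<in> topspace X \<Longrightarrow>
                 \<phi> h (\<kappa> k x) = \<kappa> k (\<phi> h x)"
    and min: "\<And>Y. subflow H X \<phi> Y \<Longrightarrow> subflow K X \<kappa> Y \<Longrightarrow> Y = topspace X"
    and \<pi>: "G_map H X \<phi> M \<mu> \<pi>" and inv: "\<And>k x. k \<in> carrier K \<Longrightarrow> x \<in> topspace X \<Longrightarrow> \<pi> (\<kappa> k x) = \<pi> x"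
    and q: "q \<in> topspace X" "q' \<in> topspace X" "\<pi> q = \<pi> q'"
  shows "q' \<in> X closure_of orbit K \<kappa> q"
proof -
  have T: "topspace T = carrier H"
    using CAP by (simp add: CAP_def topological_group_def)
  have M': "flow H T M \<mu>" using M by (simp add: universal_minimal_flow_def minimal_flow_def)
  have HX: "Hausdorff_space X" using X by (simp add: flow_def)
  have HM: "Hausdorff_space M" using M' by (simp add: flow_def)
  define S where "S = topspace M"
  define P where "P = product_topology (\<lambda>_. X) S"
  define \<beta> where "\<beta> = power_action S X \<kappa>"
  define \<F> where "\<F> = {f \<in> topspace P. G_map H M \<mu> X \<phi> f}"
  have P: "flow K T' P \<beta>" unfolding P_def \<beta>_def by (rule flow_power[OF K])
  then have CP: "compact_space P" and HP: "Hausdorff_space P" by (auto simp: flow_def)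
  have \<beta>: "\<beta> k f = (\<lambda>x\<in>S. \<kappa> k (f x))" if "f \<in> topspace P" for k f
    using that unfolding \<beta>_def P_def by (rule power_action_apply)
  have fX: "f x \<in> topspace X" if "f \<in> topspace P" "x \<in> S" for f x
    using that by (auto simp: P_def)
  have S_inv: "\<mu> h x \<in> S" if "h \<in> carrier H" "x \<in> S" for h x
    using that flow_closed[OF M'] by (simp add: S_def)
  have ev: "continuous_map (prod_topology (subtopology P \<F>) M) X (\<lambda>(f, x). f x)"
    unfolding \<F>_def P_def S_def by (rule CAP_closedin_G_maps(2)[OF CAP M X])
  have "subflow K P \<beta> \<F>"
    unfolding subflow_def
  proof (intro conjI ballI)
    show "closedin P \<F>"
      unfolding \<F>_def P_def S_def by (rule CAP_closedin_G_maps(1)[OF CAP M X])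
    obtain Y where Y: "subflow H X \<phi> Y" "\<And>W. subflow H X \<phi> W \<Longrightarrow> W \<subseteq> Y \<Longrightarrow> W = Y"
      using minimal_subflow_exists[OF X] by blast
    then have "minimal_flow H T (subtopology X Y) (\<lambda>h. restrict (\<phi> h) Y)"
      using minimal_flow_restrict_iff[OF X T Y(1)] by blast
    then obtain f where "G_map H M \<mu> (subtopology X Y) (\<lambda>h. restrict (\<phi> h) Y) f"
      using universal_minimal_flow_onto[OF M T] by blast
    then have f: "G_map H M \<mu> X \<phi> f" by (rule G_map_into_restrict(1))
    then have "continuous_map M X (restrict f S)"
      unfolding G_map_def S_def by (auto intro: continuous_map_eq)
    moreover from this have "restrict f S \<in> topspace P"
      using continuous_map_image_subset_topspace unfolding P_def S_def by fastforce
    ultimately have "restrict f S \<in> \<F>"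
      using f S_inv by (auto simp: \<F>_def G_map_def S_def[symmetric])
    then show "\<F> \<noteq> {}" by blast
    fix k f assume k: "k \<in> carrier K" and f: "f \<in> \<F>"
    then have fP: "f \<in> topspace P" and fG: "G_map H M \<mu> X \<phi> f" by (auto simp: \<F>_def)
    have "continuous_map M X (\<kappa> k \<circ> f)"
      using fG flow_continuous[OF K T' k] by (auto simp: G_map_def intro: continuous_map_compose)
    then have "continuous_map M X (\<beta> k f)"
      by (rule continuous_map_eq) (use \<beta>[OF fP] in \<open>auto simp: S_def\<close>)
    moreover have "\<beta> k f (\<mu> h x) = \<phi> h (\<beta> k f x)" if "h \<in> carrier H" "x \<in> topspace M" for h x
      using \<beta>[OF fP] fG k that comm fX[OF fP] S_inv by (auto simp: G_map_def S_def)
    ultimately show "\<beta> k f \<in> \<F>"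
      using flow_closed[OF P k fP] by (simp add: \<F>_def G_map_def)
  qed
  then obtain \<E> where \<E>: "subflow K P \<beta> \<E>" "\<E> \<subseteq> \<F>" and min\<E>: "\<And>W. subflow K P \<beta> W \<Longrightarrow> W \<subseteq> \<E> \<Longrightarrow> W = \<E>"
    using minimal_subflow_within[OF P T'] by blast
  have EP: "f \<in> topspace P" and EG: "G_map H M \<mu> X \<phi> f" if "f \<in> \<E>" for f
    using that \<E>(2) by (auto simp: \<F>_def)
  have dense: "P closure_of orbit K \<beta> f = \<E>" if "f \<in> \<E>" for f
    using min\<E>[OF subflow_orbit_closure(1)[OF P T' EP[OF that]]] subflow_closure_subset[OF \<E>(1) that] by blast
  define R where "R = (\<lambda>(f, x). f x) ` (\<E> \<times> S)"
  have "R = topspace X"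
  proof (rule min)
    have "compactin P \<E>" using \<E>(1) CP by (simp add: subflow_def closedin_compact_space)
    then have "compactin (subtopology P \<F>) \<E>" using \<E>(2) by (simp add: compactin_subtopology)
    moreover have "compactin M S" using M' by (simp add: flow_def compact_space_def S_def)
    ultimately have "compactin (prod_topology (subtopology P \<F>) M) (\<E> \<times> S)"
      by (simp add: compactin_Times)
    then have "compactin X R" unfolding R_def by (rule image_compactin[OF _ ev])
    then have cl: "closedin X R" by (rule compactin_imp_closedin[OF HX])
    have ne: "R \<noteq> {}" using \<E>(1) M' by (auto simp: R_def subflow_def flow_def S_def)
    show "subflow H X \<phi> R"
      unfolding subflow_def
    proof (intro conjI ballI cl ne)
      fix h r assume h: "h \<in> carrier H" and "r \<in> R"
      then obtain f x where fx: "f \<in> \<E>" "x \<in> S" "r = f x" by (auto simp: R_def)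
      then have "\<phi> h r = f (\<mu> h x)" using EG[OF fx(1)] h by (simp add: G_map_def S_def)
      then show "\<phi> h r \<in> R" using fx S_inv[OF h] by (auto simp: R_def)
    qed
    show "subflow K X \<kappa> R"
      unfolding subflow_def
    proof (intro conjI ballI cl ne)
      fix k r assume k: "k \<in> carrier K" and "r \<in> R"
      then obtain f x where fx: "f \<in> \<E>" "x \<in> S" "r = f x" by (auto simp: R_def)
      then have "\<kappa> k r = \<beta> k f x" using \<beta>[OF EP[OF fx(1)]] by simp
      moreover have "\<beta> k f \<in> \<E>" using \<E>(1) k fx(1) by (simp add: subflow_def)
      ultimately show "\<kappa> k r \<in> R" using fx(2) by (auto simp: R_def)
    qed
  qed
  moreover have R_D: "\<exists>f\<in>\<E>. \<exists>x\<in>S. r = f x" if "r \<in> R" for r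
    using that by (auto simp: R_def)
  ultimately obtain f x f' x' where f: "f \<in> \<E>" "x \<in> S" "q = f x" and f': "f' \<in> \<E>" "x' \<in> S" "q' = f' x'"
    using q(1,2) R_D by metis
  have f'_cl: "f' \<in> P closure_of orbit K \<beta> f" using dense[OF f(1)] f'(1) by simp
  have proj: "continuous_map P X (\<lambda>f. f y)" if "y \<in> S" for y
    unfolding P_def using that by (rule continuous_map_product_projection)
  have \<pi>f: "\<pi> (f' y) = \<pi> (f y)" if y: "y \<in> S" for y
  proof (rule forall_in_closure_of_eq[OF f'_cl HM, where f = "\<lambda>g. \<pi> (g y)" and g = "\<lambda>_. \<pi> (f y)"])
    have \<pi>c: "continuous_map X M \<pi>" using \<pi> by (simp add: G_map_def)
    show "continuous_map P M (\<lambda>g. \<pi> (g y))"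
      using continuous_map_compose[OF proj[OF y] \<pi>c] by (simp add: comp_def)
    have "\<pi> (f y) \<in> topspace M"
      using \<pi>c fX[OF EP[OF f(1)] y] continuous_map_image_subset_topspace by fast
    then show "continuous_map P M (\<lambda>_. \<pi> (f y))" by simp
    show "\<pi> (g y) = \<pi> (f y)" if "g \<in> orbit K \<beta> f" for g
      using that \<beta>[OF EP[OF f(1)]] y inv fX[OF EP[OF f(1)] y] by (auto simp: orbit_def)
  qed
  have "inj_on (\<pi> \<circ> f) S"
    unfolding S_def
    by (rule universal_minimal_flow_endomorphism_inj[OF M T G_map_compose[OF EG[OF f(1)] \<pi>]])
  moreover have "(\<pi> \<circ> f) x = (\<pi> \<circ> f) x'" using q(3) f f' \<pi>f by simp
  ultimately have "x = x'" using f(2) f'(2) by (metis inj_onD)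
  have "G_map K P \<beta> X \<kappa> (\<lambda>g. g x)"
    unfolding P_def \<beta>_def using f(2) by (rule G_map_evaluation)
  then have "(\<lambda>g. g x) ` (P closure_of orbit K \<beta> f) = X closure_of orbit K \<kappa> (f x)"
    by (rule image_orbit_closure[OF P T' HX _ EP[OF f(1)]])
  then show ?thesis using f'_cl f(3) f'(3) \<open>x = x'\<close> by blast
qed

text \<open>If the orbit closures are the fibres of a function, they partition the flow, so none of them can
  properly contain another.\<close>

lemma minimal_orbit_closure_fibre:
  assumes X: "flow K T X \<kappa>" and T: "topspace T = carrier K" and q: "q \<in> topspace X"
    and fib: "\<And>x y. x \<in> topspace X \<Longrightarrow> y \<in> topspace X \<Longrightarrow>
                y \<in> X closure_of orbit K \<kappa> x \<longleftrightarrow> p x = p y"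
    and W: "subflow K X \<kappa> W" "W \<subseteq> X closure_of orbit K \<kappa> q"
  shows "W = X closure_of orbit K \<kappa> q"
proof -
  obtain w where w: "w \<in> W" using W(1) by (auto simp: subflow_def)
  have sub: "X closure_of orbit K \<kappa> q \<subseteq> topspace X" by (rule closure_of_subset_topspace)
  have "X closure_of orbit K \<kappa> q \<subseteq> X closure_of orbit K \<kappa> w"
  proof
    fix c assume c: "c \<in> X closure_of orbit K \<kappa> q"
    then have "p q = p c" "p q = p w" using fib[OF q] w W(2) sub by blast+
    then show "c \<in> X closure_of orbit K \<kappa> w" using fib[of w c] c w W(2) sub by auto
  qed
  then show ?thesis using subflow_closure_subset[OF W(1) w] W(2) by blast
qed

section \<open>Products of minimal flows\<close>

lemma minimal_flow_meets_openin:
  assumes X: "minimal_flow G T X \<phi>" and T: "topspace T = carrier G"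
    and a: "a \<in> topspace X" and U: "openin X U" "x \<in> U"
  obtains g where "g \<in> carrier G" "\<phi> g a \<in> U"
proof -
  have F: "flow G T X \<phi>" using X by (simp add: minimal_flow_def)
  have "x \<in> topspace X" using U openin_subset by blast
  then have "x \<in> X closure_of orbit G \<phi> a"
    using minimal_flowD[OF X subflow_orbit_closure(1)[OF F T a]] by simp
  then obtain y where "y \<in> orbit G \<phi> a" "y \<in> U" using U by (auto simp: in_closure_of)
  then show ?thesis using that by (auto simp: orbit_def)
qed

lemma minimal_flow_prod:
  assumes X: "minimal_flow H S X \<phi>" and Y: "minimal_flow K T Y \<psi>"
    and S: "topspace S = carrier H" and T: "topspace T = carrier K"
  shows "minimal_flow (H \<times>\<times> K) (prod_topology S T) (prod_topology X Y) (prod_action X \<phi> Y \<psi>)"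
  unfolding minimal_flow_def
proof (intro conjI allI impI)
  show "flow (H \<times>\<times> K) (prod_topology S T) (prod_topology X Y) (prod_action X \<phi> Y \<psi>)"
    using X Y by (intro flow_prod) (auto simp: minimal_flow_def)
  fix W assume W: "subflow (H \<times>\<times> K) (prod_topology X Y) (prod_action X \<phi> Y \<psi>) W"
  then have W': "closedin (prod_topology X Y) W" "W \<subseteq> topspace (prod_topology X Y)" "W \<noteq> {}"
    using subflow_subset_topspace[OF W] by (simp_all add: subflow_def)
  then obtain a b where ab: "(a, b) \<in> W" "a \<in> topspace X" "b \<in> topspace Y" by auto
  have "topspace (prod_topology X Y) \<subseteq> prod_topology X Y closure_of W"
  proof
    fix z assume z: "z \<in> topspace (prod_topology X Y)"
    have "\<exists>y. y \<in> W \<and> y \<in> A" if A: "z \<in> A" "openin (prod_topology X Y) A" for A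
    proof -
      obtain U V where UV: "openin X U" "openin Y V" "fst z \<in> U" "snd z \<in> V" "U \<times> V \<subseteq> A"
        using A unfolding openin_prod_topology_alt by (metis prod.collapse)
      obtain h where h: "h \<in> carrier H" "\<phi> h a \<in> U"
        using minimal_flow_meets_openin[OF X S ab(2) UV(1,3)] by blast
      obtain k where k: "k \<in> carrier K" "\<psi> k b \<in> V"
        using minimal_flow_meets_openin[OF Y T ab(3) UV(2,4)] by blast
      have "prod_action X \<phi> Y \<psi> (h, k) (a, b) \<in> W"
        using W ab(1) h(1) k(1) by (auto simp: subflow_def)
      then have "(\<phi> h a, \<psi> k b) \<in> W" using ab by (simp add: prod_action_def)
      then show ?thesis using h k UV(5) by blast
    qed
    then show "z \<in> prod_topology X Y closure_of W" using z by (auto simp: in_closure_of)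
  qed
  then show "W = topspace (prod_topology X Y)" using W' by (simp add: closure_of_closedin)
qed

lemma minimal_flow_product:
  assumes X: "\<And>i. i \<in> I \<Longrightarrow> minimal_flow (G i) (T i) (X i) (\<phi> i)"
    and T: "\<And>i. i \<in> I \<Longrightarrow> topspace (T i) = carrier (G i)"
  shows "minimal_flow (product_group I G) (product_topology T I) (product_topology X I)
           (product_action I X \<phi>)"
  unfolding minimal_flow_def
proof (intro conjI allI impI)
  let ?P = "product_topology X I"
  show "flow (product_group I G) (product_topology T I) ?P (product_action I X \<phi>)"
    using X by (intro flow_product) (auto simp: minimal_flow_def)
  fix W assume W: "subflow (product_group I G) ?P (product_action I X \<phi>) W"
  then have W': "closedin ?P W" "W \<subseteq> topspace ?P" "W \<noteq> {}"
    using subflow_subset_topspace[OF W] by (simp_all add: subflow_def)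
  then obtain a where a: "a \<in> W" "a \<in> topspace ?P" by blast
  have "topspace ?P \<subseteq> ?P closure_of W"
  proof
    fix z assume z: "z \<in> topspace ?P"
    have "\<exists>y. y \<in> W \<and> y \<in> A" if A: "z \<in> A" "openin ?P A" for A
    proof -
      obtain U where U: "\<And>i. i \<in> I \<Longrightarrow> openin (X i) (U i)" "z \<in> Pi\<^sub>E I U" "Pi\<^sub>E I U \<subseteq> A"
        using A unfolding openin_product_topology_alt by meson
      have "\<exists>g \<in> carrier (G i). \<phi> i g (a i) \<in> U i" if "i \<in> I" for i
      proof -
        have "a i \<in> topspace (X i)" "z i \<in> U i" using U(2) a(2) that by auto
        then show ?thesis
          using minimal_flow_meets_openin[OF X[OF that] T[OF that] _ U(1)[OF that]] by metis
      qed
      then obtain g where g: "\<And>i. i \<in> I \<Longrightarrow> g i \<in> carrier (G i) \<and> \<phi> i (g i) (a i) \<in> U i"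
        by metis
      then have "product_action I X \<phi> (restrict g I) a \<in> W"
        using W a(1) by (auto simp: subflow_def)
      moreover have "product_action I X \<phi> (restrict g I) a \<in> Pi\<^sub>E I U"
        using a(2) g by (auto simp: product_action_def)
      ultimately show ?thesis using U(3) by blast
    qed
    then show "z \<in> ?P closure_of W" using z by (auto simp: in_closure_of)
  qed
  then show "W = topspace ?P" using W' by (simp add: closure_of_closedin)
qed

section \<open>Two factors\<close>

text \<open>By universality there is a map \<open>f\<close> from \<open>Q\<close> onto the minimal flow \<open>M \<times> N\<close>. The fibres of its first
  coordinate are \<open>K\<close>-orbit closures and therefore minimal \<open>K\<close>-flows; the second coordinate maps such a
  fibre to the universal minimal \<open>K\<close>-flow \<open>N\<close>, hence is injective on it.\<close>

theorem universal_minimal_flow_prod: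
  fixes H :: "('h, 'n) monoid_scheme" and K :: "('k, 'l) monoid_scheme"
  assumes CAP: "CAP H S" and K: "topological_group K T"
    and MH: "universal_minimal_flow H S M \<mu>" and MK: "universal_minimal_flow K T N \<nu>"
    and Q: "universal_minimal_flow (H \<times>\<times> K) (prod_topology S T) Q \<rho>"
  shows "flow_isomorphic (H \<times>\<times> K) Q \<rho> (prod_topology M N) (prod_action M \<mu> N \<nu>)"
proof -
  have S: "topspace S = carrier H" and T: "topspace T = carrier K"
    using CAP K by (auto simp: CAP_def topological_group_def)
  have minM: "minimal_flow H S M \<mu>" and minN: "minimal_flow K T N \<nu>"
    and minQ: "minimal_flow (H \<times>\<times> K) (prod_topology S T) Q \<rho>"
    using MH MK Q by (auto simp: universal_minimal_flow_def)
  then have M': "flow H S M \<mu>" and N': "flow K T N \<nu>"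
    and Q': "flow (H \<times>\<times> K) (prod_topology S T) Q \<rho>" by (auto simp: minimal_flow_def)
  interpret H: group H using M' by (rule flow_group)
  interpret K: group K using N' by (rule flow_group)
  have HM: "Hausdorff_space M" and HN: "Hausdorff_space N"
    using M' N' by (auto simp: flow_def)
  obtain f where f: "G_map (H \<times>\<times> K) Q \<rho> (prod_topology M N) (prod_action M \<mu> N \<nu>) f"
    and surj: "f ` topspace Q = topspace (prod_topology M N)"
    using universal_minimal_flow_onto[OF Q _ minimal_flow_prod[OF minM minN S T]] S T by auto
  have fc: "continuous_map Q (prod_topology M N) f" using f by (simp add: G_map_def)
  have fQ: "fst (f x) \<in> topspace M" "snd (f x) \<in> topspace N" if "x \<in> topspace Q" for x
  proof -
    have "f x \<in> topspace (prod_topology M N)" using that surj by blast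
    then show "fst (f x) \<in> topspace M" "snd (f x) \<in> topspace N" by auto
  qed
  have f_eq: "f (\<rho> (h, k) x) = (\<mu> h (fst (f x)), \<nu> k (snd (f x)))"
    if "h \<in> carrier H" "k \<in> carrier K" "x \<in> topspace Q" for h k x
    using f that fQ[OF that(3)] by (auto simp: G_map_def prod_action_def case_prod_unfold mem_Times_iff)
  define \<phi> where "\<phi> h = \<rho> (h, \<one>\<^bsub>K\<^esub>)" for h
  define \<kappa> where "\<kappa> k = \<rho> (\<one>\<^bsub>H\<^esub>, k)" for k
  have \<phi>: "flow H S Q \<phi>"
    unfolding \<phi>_def using T
    by (intro flow_pullback[OF Q'] H.is_group continuous_map_pairedI continuous_map_id[unfolded id_def])
      (auto simp: hom_def)
  have \<kappa>: "flow K T Q \<kappa>"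
    unfolding \<kappa>_def using S
    by (intro flow_pullback[OF Q'] K.is_group continuous_map_pairedI continuous_map_id[unfolded id_def])
      (auto simp: hom_def)
  have \<phi>\<kappa>: "\<rho> (h, k) x = \<phi> h (\<kappa> k x)" "\<rho> (h, k) x = \<kappa> k (\<phi> h x)"
    if "h \<in> carrier H" "k \<in> carrier K" "x \<in> topspace Q" for h k x
    using that flow_mult[OF Q', of "(h, \<one>\<^bsub>K\<^esub>)" "(\<one>\<^bsub>H\<^esub>, k)" x]
      flow_mult[OF Q', of "(\<one>\<^bsub>H\<^esub>, k)" "(h, \<one>\<^bsub>K\<^esub>)" x] by (auto simp: \<phi>_def \<kappa>_def)
  have \<pi>: "G_map H Q \<phi> M \<mu> (\<lambda>x. fst (f x))"
    using continuous_map_compose[OF fc continuous_map_fst] f_eq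
    by (auto simp: G_map_def \<phi>_def comp_def)
  have \<sigma>: "G_map K Q \<kappa> N \<nu> (\<lambda>x. snd (f x))"
    using continuous_map_compose[OF fc continuous_map_snd] f_eq
    by (auto simp: G_map_def \<kappa>_def comp_def)
  have inv: "fst (f (\<kappa> k x)) = fst (f x)" if "k \<in> carrier K" "x \<in> topspace Q" for k x
    using that f_eq fQ flow_one[OF M'] by (simp add: \<kappa>_def)
  have fib: "y \<in> Q closure_of orbit K \<kappa> x \<longleftrightarrow> fst (f x) = fst (f y)"
    if xy: "x \<in> topspace Q" "y \<in> topspace Q" for x y
  proof
    assume y: "y \<in> Q closure_of orbit K \<kappa> x"
    have "fst (f y) = fst (f x)"
    proof (rule forall_in_closure_of_eq[OF y HM, where f = "\<lambda>y. fst (f y)" and g = "\<lambda>_. fst (f x)"])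
      show "continuous_map Q M (\<lambda>y. fst (f y))" using \<pi> by (simp add: G_map_def)
      show "continuous_map Q M (\<lambda>_. fst (f x))" using fQ(1)[OF xy(1)] by simp
    qed (use xy inv in \<open>auto simp: orbit_def\<close>)
    then show "fst (f x) = fst (f y)" ..
  next
    assume eq: "fst (f x) = fst (f y)"
    show "y \<in> Q closure_of orbit K \<kappa> x"
    proof (rule CAP_fibre_in_orbit_closure[where \<pi> = "\<lambda>x. fst (f x)", OF CAP MH \<phi> \<kappa> T])
      show "\<phi> h (\<kappa> k x) = \<kappa> k (\<phi> h x)" if "h \<in> carrier H" "k \<in> carrier K" "x \<in> topspace Q" for h k x
        using \<phi>\<kappa>[OF that] by simp
      show "Y = topspace Q" if "subflow H Q \<phi> Y" "subflow K Q \<kappa> Y" for Y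
      proof (rule minimal_flowD[OF minQ])
        have "Y \<subseteq> topspace Q" using that(1) by (rule subflow_subset_topspace)
        then show "subflow (H \<times>\<times> K) Q \<rho> Y"
          using that \<phi>\<kappa>(1) by (auto simp: subflow_def subset_iff)
      qed
    qed (fact \<pi> inv xy eq)+
  qed
  have inj: "inj_on f (topspace Q)"
  proof (rule inj_onI)
    fix x y assume xy: "x \<in> topspace Q" "y \<in> topspace Q" "f x = f y"
    let ?C = "Q closure_of orbit K \<kappa> x"
    have C: "subflow K Q \<kappa> ?C" "x \<in> ?C" using subflow_orbit_closure[OF \<kappa> T xy(1)] by auto
    have "y \<in> ?C" using fib xy by simp
    have "W = ?C" if "subflow K Q \<kappa> W" "W \<subseteq> ?C" for W
      using \<kappa> T xy(1) fib that
      by (rule minimal_orbit_closure_fibre[where p = "\<lambda>x. fst (f x)"])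
    then have "minimal_flow K T (subtopology Q ?C) (\<lambda>k. restrict (\<kappa> k) ?C)"
      using minimal_flow_restrict_iff[OF \<kappa> T C(1)] by blast
    then have "inj_on (\<lambda>x. snd (f x)) (topspace (subtopology Q ?C))"
      using G_map_from_restrict[OF \<sigma>] by (rule minimal_flow_onto_universal_inj[OF MK T])
    moreover have "topspace (subtopology Q ?C) = ?C"
      using closure_of_subset_topspace by (metis topspace_subtopology_subset)
    ultimately have "inj_on (\<lambda>x. snd (f x)) ?C" by simp
    then show "x = y" by (rule inj_onD) (use C(2) \<open>y \<in> ?C\<close> xy(3) in simp_all)
  qed
  have "homeomorphic_map Q (prod_topology M N) f"
    using fc Q' HM HN surj inj
    by (intro continuous_imp_homeomorphic_map) (auto simp: flow_def Hausdorff_space_prod_topology)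
  then show ?thesis using f by (auto simp: flow_isomorphic_def)
qed

section \<open>Arbitrary products\<close>

definition extend_by_one :: "'i set \<Rightarrow> ('i \<Rightarrow> ('g, 'm) monoid_scheme) \<Rightarrow> 'i set \<Rightarrow> ('i \<Rightarrow> 'g) \<Rightarrow> 'i \<Rightarrow> 'g" where
  "extend_by_one I G J g = (\<lambda>i\<in>I. if i \<in> J then g i else \<one>\<^bsub>G i\<^esub>)"

lemma flow_extend_by_one:
  assumes Q: "flow (product_group I G) (product_topology T I) Q \<rho>"
    and J: "J \<subseteq> I" and G: "\<And>i. i \<in> I \<Longrightarrow> group (G i)"
    and T: "\<And>i. i \<in> I \<Longrightarrow> topspace (T i) = carrier (G i)"
  shows "flow (product_group J G) (product_topology T J) Q (\<lambda>g. \<rho> (extend_by_one I G J g))"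
proof (rule flow_pullback[OF Q])
  have mono: "monoid (G i)" if "i \<in> I" for i using G[OF that] by (simp add: group.is_monoid)
  show "group (product_group J G)" using G J by (intro product_group) auto
  show "extend_by_one I G J \<in> hom (product_group J G) (product_group I G)"
    using mono J by (auto simp: hom_def extend_by_one_def fun_eq_iff PiE_iff monoid.one_closed
        monoid.l_one monoid.m_closed subset_iff)
  show "continuous_map (product_topology T J) (product_topology T I) (extend_by_one I G J)"
    unfolding continuous_map_componentwise
  proof (intro conjI ballI)
    fix i assume i: "i \<in> I"
    show "continuous_map (product_topology T J) (T i) (\<lambda>g. extend_by_one I G J g i)"
      using i T[OF i] mono[OF i] continuous_map_product_projection[of i J T]
      by (cases "i \<in> J") (auto simp: extend_by_one_def monoid.one_closed)
  qed (auto simp: extend_by_one_def)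
qed

lemma flow_single_factor:
  assumes Q: "flow (product_group I G) (product_topology T I) Q \<rho>"
    and j: "j \<in> I" and G: "\<And>i. i \<in> I \<Longrightarrow> group (G i)"
    and T: "\<And>i. i \<in> I \<Longrightarrow> topspace (T i) = carrier (G i)"
  shows "flow (G j) (T j) Q (\<lambda>a. \<rho> (extend_by_one I G {j} (\<lambda>_. a)))"
proof (rule flow_pullback[OF Q G[OF j]])
  have mono: "monoid (G i)" if "i \<in> I" for i using G[OF that] by (simp add: group.is_monoid)
  show "(\<lambda>a. extend_by_one I G {j} (\<lambda>_. a)) \<in> hom (G j) (product_group I G)"
    using mono j by (auto simp: hom_def extend_by_one_def fun_eq_iff PiE_iff monoid.one_closed
        monoid.l_one monoid.m_closed)
  show "continuous_map (T j) (product_topology T I) (\<lambda>a. extend_by_one I G {j} (\<lambda>_. a))"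
    unfolding continuous_map_componentwise
  proof (intro conjI ballI)
    fix i assume i: "i \<in> I"
    show "continuous_map (T j) (T i) (\<lambda>a. extend_by_one I G {j} (\<lambda>_. a) i)"
      using i T[OF i] mono[OF i] continuous_map_id[of "T j"]
      by (cases "i = j") (auto simp: extend_by_one_def monoid.one_closed id_def)
  qed (auto simp: extend_by_one_def)
qed

text \<open>By induction on \<open>N\<close>; write \<open>J\<close> for \<open>I - N\<close>. The hypothesis for \<open>N\<close> says that the fibres of \<open>(f\<^sub>i)\<^bsub>i\<in>N\<^esub>\<close> are the
  orbit closures of the partial product over \<open>J\<close>, so each fibre \<open>C\<close> is a minimal flow of that group. For
  \<open>j \<in> J\<close> this group is generated by the commuting subgroups \<open>G\<^sub>j\<close>, which is CAP, and the partial product over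
  \<open>J - {j}\<close>; two points of \<open>C\<close> with the same \<open>j\<close>-th coordinate are thus in the same orbit closure of the
  latter.\<close>

theorem CAP_product_fibre:
  fixes G :: "'i \<Rightarrow> ('g, 'm) monoid_scheme"
  assumes CAP: "\<And>i. i \<in> I \<Longrightarrow> CAP (G i) (T i)"
    and M: "\<And>i. i \<in> I \<Longrightarrow> universal_minimal_flow (G i) (T i) (M i) (\<mu> i)"
    and Q: "minimal_flow (product_group I G) (product_topology T I) Q \<rho>"
    and f: "G_map (product_group I G) Q \<rho> (product_topology M I) (product_action I M \<mu>) f"
    and "finite N" "N \<subseteq> I" "q \<in> topspace Q" "q' \<in> topspace Q" "\<And>i. i \<in> N \<Longrightarrow> f q i = f q' i"
  shows "q' \<in> Q closure_of orbit (product_group (I - N) G) (\<lambda>g. \<rho> (extend_by_one I G (I - N) g)) q"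
proof -
  have T: "topspace (T i) = carrier (G i)" and grp: "group (G i)" if "i \<in> I" for i
    using CAP[OF that] by (auto simp: CAP_def topological_group_def)
  have TI: "topspace (product_topology T J) = carrier (product_group J G)" if "J \<subseteq> I" for J
    using T that by (auto simp: PiE_iff subset_iff)
  have Q': "flow (product_group I G) (product_topology T I) Q \<rho>"
    using Q by (simp add: minimal_flow_def)
  show ?thesis
    using assms(5-)
  proof (induction N arbitrary: q q' rule: finite_induct)
    case empty
    have "extend_by_one I G I g = g" if "g \<in> carrier (product_group I G)" for g
      using that by (auto simp: extend_by_one_def fun_eq_iff PiE_iff extensional_def)
    then have "orbit (product_group I G) (\<lambda>g. \<rho> (extend_by_one I G (I - {}) g)) q
        = orbit (product_group I G) \<rho> q"
      unfolding orbit_def Diff_empty by (intro Collect_cong ex_cong1 rev_conj_cong) simp_all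
    then show ?case
      using minimal_flowD[OF Q subflow_orbit_closure(1)[OF Q' TI[OF order_refl]]] empty by simp
  next
    case (insert j N)
    define J where "J = I - N"
    define J' where "J' = I - insert j N"
    have j: "j \<in> I" "j \<in> J" "J = insert j J'" "j \<notin> J'" and JI: "J \<subseteq> I" "J' \<subseteq> I"
      using insert.hyps insert.prems by (auto simp: J_def J'_def)
    define \<kappa> where "\<kappa> J g = \<rho> (extend_by_one I G J g)" for J g
    define \<phi> where "\<phi> a = \<rho> (extend_by_one I G {j} (\<lambda>_. a))" for a
    have \<kappa>: "flow (product_group J G) (product_topology T J) Q (\<kappa> J)" if "J \<subseteq> I" for J
      unfolding \<kappa>_def by (rule flow_extend_by_one[OF Q' that grp T])
    have \<phi>: "flow (G j) (T j) Q \<phi>"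
      unfolding \<phi>_def by (rule flow_single_factor[OF Q' j(1) grp T])
    have ext_carrier: "extend_by_one I G J g \<in> carrier (product_group I G)"
      if "g \<in> carrier (product_group J G)" for J g
      using that grp by (auto simp: extend_by_one_def group.is_monoid monoid.one_closed)
    have single_carrier: "extend_by_one I G {j} (\<lambda>_. a) \<in> carrier (product_group I G)"
      if "a \<in> carrier (G j)" for a
      using that grp by (auto simp: extend_by_one_def group.is_monoid monoid.one_closed)
    have split: "\<phi> a (\<kappa> J' k x) = \<kappa> J (k(j := a)) x" "\<kappa> J' k (\<phi> a x) = \<kappa> J (k(j := a)) x"
      "k(j := a) \<in> carrier (product_group J G)"
      if a: "a \<in> carrier (G j)" and k: "k \<in> carrier (product_group J' G)" and x: "x \<in> topspace Q" for a k x
    proof -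
      have kG: "k i \<in> carrier (G i)" if "i \<in> J'" for i using k that by auto
      have "extend_by_one I G {j} (\<lambda>_. a) \<otimes>\<^bsub>product_group I G\<^esub> extend_by_one I G J' k
          = extend_by_one I G J (k(j := a))"
        "extend_by_one I G J' k \<otimes>\<^bsub>product_group I G\<^esub> extend_by_one I G {j} (\<lambda>_. a)
          = extend_by_one I G J (k(j := a))"
        using a kG j JI grp
        by (auto simp: extend_by_one_def fun_eq_iff group.is_monoid monoid.r_one monoid.l_one)
      then show "\<phi> a (\<kappa> J' k x) = \<kappa> J (k(j := a)) x" "\<kappa> J' k (\<phi> a x) = \<kappa> J (k(j := a)) x"
        using flow_mult[OF Q' single_carrier[OF a] ext_carrier[OF k] x]
          flow_mult[OF Q' ext_carrier[OF k] single_carrier[OF a] x]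
        by (simp_all add: \<phi>_def \<kappa>_def)
      show "k(j := a) \<in> carrier (product_group J G)"
        using a k j(3) by (auto simp: PiE_iff extensional_def)
    qed
    have fc: "continuous_map Q (M i) (\<lambda>x. f x i)" if "i \<in> I" for i
      using f that by (simp add: G_map_def continuous_map_componentwise)
    have f\<rho>: "f (\<rho> g x) i = \<mu> i (g i) (f x i)"
      if "g \<in> carrier (product_group I G)" "x \<in> topspace Q" "i \<in> I" for g x i
    proof -
      have "f x \<in> topspace (product_topology M I)"
        using f that(2) continuous_map_image_subset_topspace unfolding G_map_def by fast
      then show ?thesis using f that by (auto simp: G_map_def product_action_def)
    qed
    have f_one: "f (\<rho> g x) i = f x i"
      if "g \<in> carrier (product_group I G)" "x \<in> topspace Q" "i \<in> I" "g i = \<one>\<^bsub>G i\<^esub>" for g x i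
    proof -
      have "flow (G i) (T i) (M i) (\<mu> i)"
        using M[OF that(3)] by (simp add: universal_minimal_flow_def minimal_flow_def)
      moreover have "f x i \<in> topspace (M i)"
        using fc[OF that(3)] that(2) continuous_map_image_subset_topspace by fast
      ultimately show ?thesis using f\<rho>[OF that(1-3)] that(4) flow_one by metis
    qed
    have fib: "y \<in> Q closure_of orbit (product_group J G) (\<kappa> J) x \<longleftrightarrow> restrict (f x) N = restrict (f y) N"
      if xy: "x \<in> topspace Q" "y \<in> topspace Q" for x y
    proof
      assume y: "y \<in> Q closure_of orbit (product_group J G) (\<kappa> J) x"
      have "f y i = f x i" if i: "i \<in> N" for i
      proof (rule forall_in_closure_of_eq[OF y, where f = "\<lambda>y. f y i" and g = "\<lambda>_. f x i"])
        have iI: "i \<in> I" "i \<notin> J" using i insert.prems by (auto simp: J_def)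
        show "Hausdorff_space (M i)"
          using M[OF iI(1)] by (simp add: universal_minimal_flow_def minimal_flow_def flow_def)
        show "continuous_map Q (M i) (\<lambda>y. f y i)" by (rule fc[OF iI(1)])
        then show "continuous_map Q (M i) (\<lambda>_. f x i)"
          using xy(1) continuous_map_image_subset_topspace by fastforce
        show "f z i = f x i" if z: "z \<in> orbit (product_group J G) (\<kappa> J) x" for z
        proof -
          obtain g where g: "g \<in> carrier (product_group J G)" "z = \<kappa> J g x"
            using z unfolding orbit_def by blast
          then show ?thesis
            using f_one[OF ext_carrier[OF g(1)] xy(1) iI(1)] iI by (simp add: \<kappa>_def extend_by_one_def)
        qed
      qed
      then show "restrict (f x) N = restrict (f y) N" by (simp cong: restrict_cong)
    next
      assume "restrict (f x) N = restrict (f y) N"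
      then have "f x i = f y i" if "i \<in> N" for i using that by (metis restrict_apply')
      then show "y \<in> Q closure_of orbit (product_group J G) (\<kappa> J) x"
        using insert.IH[of x y] insert.prems(1) xy by (simp add: J_def \<kappa>_def[abs_def])
    qed
    define C where "C = Q closure_of orbit (product_group J G) (\<kappa> J) q"
    define X where "X = subtopology Q C"
    have C: "subflow (product_group J G) Q (\<kappa> J) C" "q \<in> C"
      unfolding C_def using subflow_orbit_closure[OF \<kappa>[OF JI(1)] TI[OF JI(1)] insert.prems(2)] by auto
    have minC: "W = C" if "subflow (product_group J G) Q (\<kappa> J) W" "W \<subseteq> C" for W
      using \<kappa>[OF JI(1)] TI[OF JI(1)] insert.prems(2) fib that unfolding C_def
      by (rule minimal_orbit_closure_fibre[where p = "\<lambda>x. restrict (f x) N"])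
    have CQ: "C \<subseteq> topspace Q" "closedin Q C"
      using subflow_subset_topspace[OF C(1)] C(1) by (simp_all add: subflow_def)
    have topX: "topspace X = C" using CQ by (auto simp: X_def)
    have q': "q' \<in> C"
      unfolding C_def fib[OF insert.prems(2,3)] using insert.prems(4)
      by (auto simp: restrict_def fun_eq_iff)
    have one': "\<one>\<^bsub>product_group J' G\<^esub> \<in> carrier (product_group J' G)"
      using grp JI(2) by (auto simp: group.is_monoid monoid.one_closed)
    have one: "\<one>\<^bsub>G j\<^esub> \<in> carrier (G j)" using grp[OF j(1)] by (simp add: group.is_monoid monoid.one_closed)
    have \<phi>C: "\<phi> a x \<in> C" if "a \<in> carrier (G j)" "x \<in> C" for a x
      using split(1,3)[OF that(1) one', of x] that(2) CQ(1) C(1) flow_one[OF \<kappa>[OF JI(2)], of x]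
      by (auto simp: subflow_def subset_iff simp del: one_product_group)
    have \<kappa>C: "\<kappa> J' k x \<in> C" if "k \<in> carrier (product_group J' G)" "x \<in> C" for k x
      using split(2,3)[OF one that(1), of x] that(2) CQ(1) C(1) flow_one[OF \<phi>, of x]
      by (auto simp: subflow_def subset_iff)
    have sub\<phi>: "subflow (G j) Q \<phi> C" and sub\<kappa>: "subflow (product_group J' G) Q (\<kappa> J') C"
      using \<phi>C \<kappa>C C(2) CQ(2) by (auto simp: subflow_def)
    have "q' \<in> X closure_of orbit (product_group J' G) (\<lambda>k. restrict (\<kappa> J' k) C) q"
    proof (rule CAP_fibre_in_orbit_closure[where \<pi> = "\<lambda>x. f x j", OF CAP[OF j(1)] M[OF j(1)] _ _ TI[OF JI(2)]])
      show "flow (G j) (T j) X (\<lambda>a. restrict (\<phi> a) C)"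
        unfolding X_def by (rule flow_restrict[OF \<phi> T[OF j(1)] sub\<phi>])
      show "flow (product_group J' G) (product_topology T J') X (\<lambda>k. restrict (\<kappa> J' k) C)"
        unfolding X_def by (rule flow_restrict[OF \<kappa>[OF JI(2)] TI[OF JI(2)] sub\<kappa>])
      show "restrict (\<phi> a) C (restrict (\<kappa> J' k) C x) = restrict (\<kappa> J' k) C (restrict (\<phi> a) C x)"
        if "a \<in> carrier (G j)" "k \<in> carrier (product_group J' G)" "x \<in> topspace X" for a k x
        using that split(1,2)[OF that(1,2), of x] \<phi>C[OF that(1)] \<kappa>C[OF that(2)] CQ(1) topX by auto
      show "Y = topspace X"
        if "subflow (G j) X (\<lambda>a. restrict (\<phi> a) C) Y"
          "subflow (product_group J' G) X (\<lambda>k. restrict (\<kappa> J' k) C) Y" for Y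
      proof -
        have Y: "subflow (G j) Q \<phi> Y" "subflow (product_group J' G) Q (\<kappa> J') Y" "Y \<subseteq> C"
          using that CQ(2) by (auto simp: X_def subflow_restrict_iff)
        have "\<kappa> J g y \<in> Y" if g: "g \<in> carrier (product_group J G)" and y: "y \<in> Y" for g y
        proof -
          have gj: "g j \<in> carrier (G j)" and gJ': "restrict g J' \<in> carrier (product_group J' G)"
            using g j(3) by auto
          have "(restrict g J')(j := g j) = g"
            using g j(3) by (auto simp: fun_eq_iff PiE_iff extensional_def)
          then have "\<kappa> J g y = \<phi> (g j) (\<kappa> J' (restrict g J') y)"
            using split(1)[OF gj gJ', of y] y Y(3) CQ(1) by auto
          then show ?thesis using Y(1,2) y gj gJ' by (simp add: subflow_def)
        qed
        then have "subflow (product_group J G) Q (\<kappa> J) Y" using Y(1) by (simp add: subflow_def)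
        then show ?thesis using minC Y(3) topX by blast
      qed
      show "G_map (G j) X (\<lambda>a. restrict (\<phi> a) C) (M j) (\<mu> j) (\<lambda>x. f x j)"
        unfolding G_map_def
      proof (intro conjI ballI)
        show "continuous_map X (M j) (\<lambda>x. f x j)"
          unfolding X_def using fc[OF j(1)] by (rule continuous_map_from_subtopology)
        fix a x assume a: "a \<in> carrier (G j)" and x: "x \<in> topspace X"
        then have "x \<in> C" "x \<in> topspace Q" using topX CQ(1) by auto
        then show "f (restrict (\<phi> a) C x) j = \<mu> j a (f x j)"
          using f\<rho>[OF single_carrier[OF a] _ j(1)] j(1) by (simp add: \<phi>_def extend_by_one_def)
      qed
      show "f (restrict (\<kappa> J' k) C x) j = f x j"
        if "k \<in> carrier (product_group J' G)" "x \<in> topspace X" for k x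
        using f_one[OF ext_carrier[OF that(1)] _ j(1), of x] that(2) topX CQ(1) j
        by (auto simp: \<kappa>_def extend_by_one_def)
      show "q \<in> topspace X" "q' \<in> topspace X" using C(2) q' topX by auto
      show "f q j = f q' j" using insert.prems(4) by simp
    qed
    also have "\<dots> \<subseteq> Q closure_of orbit (product_group J' G) (\<lambda>k. restrict (\<kappa> J' k) C) q"
      unfolding X_def by (rule closure_of_subtopology_subset)
    also have "orbit (product_group J' G) (\<lambda>k. restrict (\<kappa> J' k) C) q = orbit (product_group J' G) (\<kappa> J') q"
      using C(2) by (auto simp: orbit_def)
    finally show ?case by (simp add: J'_def \<kappa>_def[abs_def])
  qed
qed

text \<open>A map \<open>f\<close> from \<open>Q\<close> onto the minimal flow \<open>\<Prod>\<^sub>i M\<^sub>i\<close> exists by universality, and it has to be shown injective. A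
  continuous function \<open>u\<close> on \<open>Q\<close> varies little under some basic neighbourhood of the identity, which
  contains the full partial product over all but finitely many indices \<open>N\<close>. Points with the same image
  under \<open>f\<close> agree in the coordinates in \<open>N\<close>, hence lie in one orbit closure of that partial product, where
  \<open>u\<close> is almost constant. So no \<open>u\<close> separates them.\<close>

theorem universal_minimal_flow_product:
  fixes G :: "'i \<Rightarrow> ('g, 'm) monoid_scheme"
  assumes CAP: "\<And>i. i \<in> I \<Longrightarrow> CAP (G i) (T i)"
    and M: "\<And>i. i \<in> I \<Longrightarrow> universal_minimal_flow (G i) (T i) (M i) (\<mu> i)"
    and Q: "universal_minimal_flow (product_group I G) (product_topology T I) Q \<rho>"
  shows "flow_isomorphic (product_group I G) Q \<rho> (product_topology M I) (product_action I M \<mu>)"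
proof -
  let ?P = "product_topology M I"
  have T: "topspace (T i) = carrier (G i)" and grp: "group (G i)" if "i \<in> I" for i
    using CAP[OF that] by (auto simp: CAP_def topological_group_def)
  have TI: "topspace (product_topology T I) = carrier (product_group I G)"
    using T by (auto simp: PiE_iff)
  have minM: "minimal_flow (G i) (T i) (M i) (\<mu> i)" if "i \<in> I" for i
    using M[OF that] by (simp add: universal_minimal_flow_def)
  have minQ: "minimal_flow (product_group I G) (product_topology T I) Q \<rho>"
    using Q by (simp add: universal_minimal_flow_def)
  then have Q': "flow (product_group I G) (product_topology T I) Q \<rho>" by (simp add: minimal_flow_def)
  then have HQ: "Hausdorff_space Q" "compact_space Q" by (auto simp: flow_def)
  obtain f where f: "G_map (product_group I G) Q \<rho> ?P (product_action I M \<mu>) f"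
    and surj: "f ` topspace Q = topspace ?P"
    using universal_minimal_flow_onto[OF Q TI minimal_flow_product[OF minM T]] by blast
  have inj: "inj_on f (topspace Q)"
  proof (rule inj_onI, rule ccontr)
    fix x y assume x: "x \<in> topspace Q" and y: "y \<in> topspace Q" and eq: "f x = f y" and ne: "x \<noteq> y"
    have "normal_space Q" using HQ by (simp add: compact_Hausdorff_or_regular_imp_normal_space)
    then obtain u :: "_ \<Rightarrow> real" where "continuous_map Q (top_of_set {0..1}) u" and u: "u ` {x} \<subseteq> {0}" "u ` {y} \<subseteq> {1}"
      using x y HQ ne by (elim Urysohn_lemma[of Q "{x}" "{y}" 0 1]) (auto simp: closedin_Hausdorff_singleton)
    then have uc: "continuous_map Q euclideanreal u" by (simp add: continuous_map_in_subtopology)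
    obtain U where U: "openin (product_topology T I) U" "\<one>\<^bsub>product_group I G\<^esub> \<in> U"
      "\<And>g z. g \<in> U \<Longrightarrow> z \<in> topspace Q \<Longrightarrow> \<bar>u (\<rho> g z) - u z\<bar> < 1/2"
      using flow_uniformly_small_displacement[OF Q' TI uc, of "1/2"] by auto
    then obtain V where V: "finite {i \<in> I. V i \<noteq> topspace (T i)}"
      "\<one>\<^bsub>product_group I G\<^esub> \<in> Pi\<^sub>E I V" "Pi\<^sub>E I V \<subseteq> U"
      unfolding openin_product_topology_alt by meson
    define N where "N = {i \<in> I. V i \<noteq> topspace (T i)}"
    let ?\<kappa> = "\<lambda>g. \<rho> (extend_by_one I G (I - N) g)"
    have cl: "y \<in> Q closure_of orbit (product_group (I - N) G) ?\<kappa> x"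
      using V(1) x y eq by (intro CAP_product_fibre[OF CAP M minQ f]) (auto simp: N_def)
    have "u y \<le> 1/2"
    proof (rule forall_in_closure_of[OF cl])
      show "closedin Q {z \<in> topspace Q. u z \<le> 1/2}"
        using uc by (intro closedin_continuous_maps_le) auto
      fix z assume "z \<in> orbit (product_group (I - N) G) ?\<kappa> x"
      then obtain g where g: "g \<in> carrier (product_group (I - N) G)" "z = ?\<kappa> g x"
        by (auto simp: orbit_def)
      have "extend_by_one I G (I - N) g \<in> Pi\<^sub>E I V"
        using g(1) V(2) T by (auto simp: extend_by_one_def N_def PiE_iff)
      then have "\<bar>u z - u x\<bar> < 1/2" using U(3)[OF _ x] V(3) g(2) by blast
      then show "u z \<le> 1/2" using u(1) by auto
    qed
    then show False using u(2) by auto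
  qed
  have "Hausdorff_space ?P"
    using minM by (auto simp: Hausdorff_space_product_topology minimal_flow_def flow_def)
  then have "homeomorphic_map Q ?P f"
    using f surj inj HQ by (intro continuous_imp_homeomorphic_map) (auto simp: G_map_def)
  then show ?thesis using f by (auto simp: flow_isomorphic_def)
qed

theorem proposition7p7:
  fixes I :: "'i set"
    and G :: "'i \<Rightarrow> ('g, 'm) monoid_scheme" and T :: "'i \<Rightarrow> 'g topology"
    and M :: "'i \<Rightarrow> 'x topology" and \<mu> :: "'i \<Rightarrow> 'g \<Rightarrow> 'x \<Rightarrow> 'x"
    and P :: "'p topology" and \<pi> :: "('i \<Rightarrow> 'g) \<Rightarrow> 'p \<Rightarrow> 'p"
    and H :: "('h, 'n) monoid_scheme" and T\<^sub>H :: "'h topology"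
    and K :: "('k, 'l) monoid_scheme" and T\<^sub>K :: "'k topology"
    and M\<^sub>H :: "'y topology" and \<mu>\<^sub>H :: "'h \<Rightarrow> 'y \<Rightarrow> 'y"
    and M\<^sub>K :: "'z topology" and \<mu>\<^sub>K :: "'k \<Rightarrow> 'z \<Rightarrow> 'z"
    and Q :: "'q topology" and \<rho> :: "'h \<times> 'k \<Rightarrow> 'q \<Rightarrow> 'q"
  shows
    "((\<forall>i\<in>I. CAP (G i) (T i)) \<and>
      (\<forall>i\<in>I. universal_minimal_flow (G i) (T i) (M i) (\<mu> i)) \<and>
      universal_minimal_flow (product_group I G) (product_topology T I) P \<pi>
        \<longrightarrow> flow_isomorphic (product_group I G)
              P \<pi> (product_topology M I) (product_action I M \<mu>)) \<and>
     (topological_group H T\<^sub>H \<and> topological_group K T\<^sub>K \<and> CAP H T\<^sub>H \<and>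
      universal_minimal_flow H T\<^sub>H M\<^sub>H \<mu>\<^sub>H \<and> universal_minimal_flow K T\<^sub>K M\<^sub>K \<mu>\<^sub>K \<and>
      universal_minimal_flow (H \<times>\<times> K) (prod_topology T\<^sub>H T\<^sub>K) Q \<rho>
        \<longrightarrow> flow_isomorphic (H \<times>\<times> K)
              Q \<rho> (prod_topology M\<^sub>H M\<^sub>K) (prod_action M\<^sub>H \<mu>\<^sub>H M\<^sub>K \<mu>\<^sub>K))"
proof (intro conjI impI; elim conjE)
  assume "\<forall>i\<in>I. CAP (G i) (T i)" "\<forall>i\<in>I. universal_minimal_flow (G i) (T i) (M i) (\<mu> i)"
    "universal_minimal_flow (product_group I G) (product_topology T I) P \<pi>"
  then show "flow_isomorphic (product_group I G)
      P \<pi> (product_topology M I) (product_action I M \<mu>)"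
    by (intro universal_minimal_flow_product[where T = T]) simp_all
next
  assume "topological_group K T\<^sub>K" "CAP H T\<^sub>H"
    "universal_minimal_flow H T\<^sub>H M\<^sub>H \<mu>\<^sub>H" "universal_minimal_flow K T\<^sub>K M\<^sub>K \<mu>\<^sub>K"
    "universal_minimal_flow (H \<times>\<times> K) (prod_topology T\<^sub>H T\<^sub>K) Q \<rho>"
  then show "flow_isomorphic (H \<times>\<times> K)
      Q \<rho> (prod_topology M\<^sub>H M\<^sub>K) (prod_action M\<^sub>H \<mu>\<^sub>H M\<^sub>K \<mu>\<^sub>K)"
    by (intro universal_minimal_flow_prod[where S = "T\<^sub>H" and T = "T\<^sub>K"])
qed

end
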